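(* Let $\mathbb{X}$ be a Polish space, $\mathfrak{q},\mathfrak{q}_0$ two EPPFs, $H_0$ a probability measure on $\mathbb{X}$ (not necessarily diffuse), and $[\xi_{i,j}]_{i=1,\dots,I,\,j\ge1}$ a $HSSM(\mathfrak{q},\mathfrak{q}_0,H_0)$. Let $n_1(t),\dots,n_I(t)$ be positive integers, $n(t)=\sum_{i=1}^In_i(t)$, and let $\tilde D_{i,t}$ be the number of distinct values in $\{\xi_{i,j}:j=1,\dots,n_i(t)\}$ and $\tilde D_t$ the number of distinct values in $\mathcal{O}_t=\{\xi_{i,j}:j=1,\dots,n_i(t),\ i=1,\dots,I\}$. Let $H_0^*(d|k)$ (for $1\le d\le k$) be the probability of observing exactly $d$ distinct values in the vector $(\phi_1,\dots,\phi_k)$, where the $\phi_n$ are i.i.d. with law $H_0$. Then, for every $i=1,\dots,I$, $$\mathbb{P}\{\tilde D_{i,t}=d\}=\sum_{k=d}^{n_i(t)}H_0^*(d|k)\,\mathbb{P}\{D_{i,t}=k\},\qquad d=1,\dots,n_i(t),$$ and $$\mathbb{P}\{\tilde D_t=d\}=\sum_{k=d}^{n(t)}H_0^*(d|k)\,\mathbb{P}\{D_t=k\},\qquad d=1,\dots,n(t),$$ where $D_{i,t}$ and $D_t$ are defined in the context. If $H_0$ is diffuse, then $\mathbb{P}\{\tilde D_{i,t}=d\}=\mathbb{P}\{D_{i,t}=d\}$ and $\mathbb{P}\{\tilde D_t=d\}=\mathbb{P}\{D_t=d\}$ for every $d\ge1$.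
   Context: Partitions. $\mathcal{P}_n$ is the set of partitions of $\{1,\dots,n\}$, written $\pi_n=[\pi_{1,n},\dots,\pi_{k,n}]$; $|\pi_n|=k$ is the number of blocks. An exchangeable random partition of $\mathbb{N}$ is a sequence $\Pi=(\Pi_n)_n$ of random partitions of $\{1,\dots,n\}$, consistent under restriction, each with permutation-invariant law; its EPPF is the symmetric function $\mathfrak{q}$ with $\mathbb{P}\{\Pi_n=\pi_n\}=\mathfrak{q}(|\pi_{1,n}|,\dots,|\pi_{k,n}|)=:\mathfrak{q}(\pi_n)$. $p\sim SSrp(\mathfrak{q}_0,H_0)$ means that $p=\sum_{j\ge1}\tilde q_j\delta_{Z_j}$, with $(Z_j)_j$ i.i.d. with law $H_0$, independent of the nonnegative random weights $(\tilde q_j)_j$ with $\sum_j\tilde q_j=1$ a.s., and $\mathfrak{q}_0(n_1,\dots,n_k)=\sum_{j_1,\dots,j_k}\mathbb{E}\big[\prod_{i=1}^k\tilde q_{j_i}^{\,n_i}\big]$, the sum over ordered $k$-tuples of distinct positive integers. An array $[\xi_{i,j}]$ of $\mathbb{X}$-valued random variables is a $HSSM(\mathfrak{q},\mathfrak{q}_0,H_0)$ if for all positive integers $(n_1,\dots,n_I)$ and all Borel sets $A_{i,j}$, $$\mathbb{P}\{\xi_{i,j}\in A_{i,j},\ i=1,\dots,I,\ j=1,\dots,n_i\}=\sum_{\pi^{(1)}_{n_1}\in\mathcal{P}_{n_1},\dots,\pi^{(I)}_{n_I}\in\mathcal{P}_{n_I}}\ \prod_{i=1}^I\mathfrak{q}\big(\pi^{(i)}_{n_i}\big)\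 \mathbb{E}\Big[\prod_{i=1}^I\prod_{c=1}^{|\pi^{(i)}_{n_i}|}\tilde p\Big(\bigcap_{j\in\pi^{(i)}_{c,n_i}}A_{i,j}\Big)\Big],\quad \tilde p\sim SSrp(\mathfrak{q}_0,H_0).$$ Latent cluster numbers. Let $\Pi^{(1)},\dots,\Pi^{(I)}$ be i.i.d. exchangeable random partitions of $\mathbb{N}$ with EPPF $\mathfrak{q}$ and $\Pi^{(0)}$ an independent exchangeable random partition with EPPF $\mathfrak{q}_0$. Then $K_{i,t}:=|\Pi^{(i)}_{n_i(t)}|$, $K_t:=\sum_{i=1}^I|\Pi^{(i)}_{n_i(t)}|$, $D_{i,t}:=|\Pi^{(0)}_{K_{i,t}}|$, $D_t:=|\Pi^{(0)}_{K_t}|$. $H_0$ is diffuse if $H_0(\{x\})=0$ for all $x$. *)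

theory Defs
  imports "HOL-Probability.Probability" "HOL-Combinatorics.Permutations"
begin

definition partitions :: "nat \<Rightarrow> nat set set set" where
  "partitions n = {\<pi>. partition_on {1..n} \<pi>}"

definition restrict_partition :: "nat \<Rightarrow> nat set set \<Rightarrow> nat set set" where
  "restrict_partition n \<pi> = (\<lambda>B. B \<inter> {1..n}) ` \<pi> - {{}}"

(* For n = 0 the only partition is the empty one, so the index 0 carries no information. *)
definition exchangeable_random_partition :: "'w measure \<Rightarrow> (nat \<Rightarrow> 'w \<Rightarrow> nat set set) \<Rightarrow> bool" where
  "exchangeable_random_partition P R \<longleftrightarrow>
     prob_space P \<and>
     (\<forall>n. R n \<in> measurable P (count_space (partitions n))) \<and>
     (\<forall>m n. n \<le> m \<longrightarrow> (\<forall>\<omega>\<in>space P. restrict_partition n (R m \<omega>) = R n \<omega>)) \<and>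
     (\<forall>n. \<forall>\<sigma>. \<sigma> permutes {1..n} \<longrightarrow> (\<forall>\<pi>\<in>partitions n.
        \<P>(\<omega> in P. R n \<omega> = (\<lambda>B. \<sigma> ` B) ` \<pi>) = \<P>(\<omega> in P. R n \<omega> = \<pi>)))"

(* A symmetric function of finite tuples of positive integers is encoded as a function on
   finite multisets, so q(\<pi>) is q at the multiset of block sizes. *)
definition at_partition :: "(nat multiset \<Rightarrow> real) \<Rightarrow> nat set set \<Rightarrow> real" where
  "at_partition q \<pi> = q (image_mset card (mset_set \<pi>))"

definition has_eppf ::
  "'w measure \<Rightarrow> (nat \<Rightarrow> 'w \<Rightarrow> nat set set) \<Rightarrow> (nat multiset \<Rightarrow> real) \<Rightarrow> bool" where
  "has_eppf P R q \<longleftrightarrow>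
     exchangeable_random_partition P R \<and>
     (\<forall>n\<ge>1. \<forall>\<pi>\<in>partitions n. \<P>(\<omega> in P. R n \<omega> = \<pi>) = at_partition q \<pi>)"

(* p is a random probability measure on the probability space N.  The atoms are indexed
   from 0 instead of 1.  Independence of the atoms from the weights is stated through the
   sigma-algebras they generate, as prob_space.indep_var needs a common value type. *)
definition SSrp ::
  "(nat multiset \<Rightarrow> real) \<Rightarrow> 'x::polish_space measure \<Rightarrow> 'v measure \<Rightarrow> ('v \<Rightarrow> 'x measure) \<Rightarrow> bool" where
  "SSrp q0 H0 N p \<longleftrightarrow>
     prob_space N \<and> p \<in> measurable N (prob_algebra borel) \<and>
     (\<exists>(w :: nat \<Rightarrow> 'v \<Rightarrow> real) (Z :: nat \<Rightarrow> 'v \<Rightarrow> 'x).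
        (\<forall>j. w j \<in> borel_measurable N) \<and>
        (AE \<omega> in N. (\<forall>j. 0 \<le> w j \<omega>) \<and> (\<lambda>j. w j \<omega>) sums 1) \<and>
        prob_space.indep_vars N (\<lambda>_. borel) Z UNIV \<and>
        (\<forall>j. distr N borel (Z j) = H0) \<and>
        prob_space.indep_set N
          (sets (vimage_algebra (space N) (\<lambda>\<omega> j. Z j \<omega>) (\<Pi>\<^sub>M j\<in>UNIV. borel)))
          (sets (vimage_algebra (space N) (\<lambda>\<omega> j. w j \<omega>) (\<Pi>\<^sub>M j\<in>UNIV. borel))) \<and>
        (AE \<omega> in N. \<forall>A\<in>sets borel.
           (\<lambda>j. w j \<omega> * measure (return borel (Z j \<omega>)) A) sums measure (p \<omega>) A) \<and>
        (\<forall>ns. ns \<noteq> [] \<and> (\<forall>m\<in>set ns. 1 \<le> m) \<longrightarrow>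
           ((\<lambda>js. \<integral>\<omega>. (\<Prod>i<length ns. w (js ! i) \<omega> ^ (ns ! i)) \<partial>N) has_sum q0 (mset ns))
             {js. length js = length ns \<and> distinct js}))"

(* \<xi> i j, for i in {1..I} and j \<ge> 1, lives on M; p is the SSrp(q0, H0) on the auxiliary
   space N whose moments appear in the law of the array.  A family of partitions indexed
   by i in {1..I} is an element \<pi> of the finite dependent product. *)
definition HSSM ::
  "nat \<Rightarrow> (nat multiset \<Rightarrow> real) \<Rightarrow> (nat multiset \<Rightarrow> real) \<Rightarrow> 'x::polish_space measure \<Rightarrow>
   'v measure \<Rightarrow> ('v \<Rightarrow> 'x measure) \<Rightarrow> 'w measure \<Rightarrow> (nat \<Rightarrow> nat \<Rightarrow> 'w \<Rightarrow> 'x) \<Rightarrow> bool" where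
  "HSSM I q q0 H0 N p M \<xi> \<longleftrightarrow>
     SSrp q0 H0 N p \<and> prob_space M \<and>
     (\<forall>i\<in>{1..I}. \<forall>j\<ge>1. \<xi> i j \<in> borel_measurable M) \<and>
     (\<forall>(n :: nat \<Rightarrow> nat) (A :: nat \<Rightarrow> nat \<Rightarrow> 'x set).
        (\<forall>i\<in>{1..I}. 1 \<le> n i) \<and> (\<forall>i\<in>{1..I}. \<forall>j\<in>{1..n i}. A i j \<in> sets borel) \<longrightarrow>
        \<P>(\<omega> in M. \<forall>i\<in>{1..I}. \<forall>j\<in>{1..n i}. \<xi> i j \<omega> \<in> A i j) =
        (\<Sum>\<pi>\<in>(\<Pi>\<^sub>E i\<in>{1..I}. partitions (n i)).
           (\<Prod>i=1..I. at_partition q (\<pi> i)) *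
           (\<integral>\<omega>. (\<Prod>i=1..I. \<Prod>B\<in>\<pi> i. measure (p \<omega>) (\<Inter>j\<in>B. A i j)) \<partial>N)))"

(* R 0 is the random partition with EPPF q0; R 1, ..., R I have EPPF q.  Each is regarded
   as a random sequence for joint independence; equality in law of R 1, ..., R I is implied
   by the common EPPF. *)
definition latent_partitions ::
  "nat \<Rightarrow> (nat multiset \<Rightarrow> real) \<Rightarrow> (nat multiset \<Rightarrow> real) \<Rightarrow>
   'u measure \<Rightarrow> (nat \<Rightarrow> nat \<Rightarrow> 'u \<Rightarrow> nat set set) \<Rightarrow> bool" where
  "latent_partitions I q q0 P R \<longleftrightarrow>
     has_eppf P (R 0) q0 \<and> (\<forall>i\<in>{1..I}. has_eppf P (R i) q) \<and>
     prob_space.indep_vars P (\<lambda>_. \<Pi>\<^sub>M n\<in>UNIV. count_space (partitions n))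
       (\<lambda>i \<omega> n. R i n \<omega>) {0..I}"

definition latent_K_group :: "(nat \<Rightarrow> nat \<Rightarrow> 'u \<Rightarrow> nat set set) \<Rightarrow> (nat \<Rightarrow> nat) \<Rightarrow> nat \<Rightarrow> 'u \<Rightarrow> nat" where
  "latent_K_group R n i \<omega> = card (R i (n i) \<omega>)"

definition latent_K :: "nat \<Rightarrow> (nat \<Rightarrow> nat \<Rightarrow> 'u \<Rightarrow> nat set set) \<Rightarrow> (nat \<Rightarrow> nat) \<Rightarrow> 'u \<Rightarrow> nat" where
  "latent_K I R n \<omega> = (\<Sum>i=1..I. card (R i (n i) \<omega>))"

definition latent_D_group :: "(nat \<Rightarrow> nat \<Rightarrow> 'u \<Rightarrow> nat set set) \<Rightarrow> (nat \<Rightarrow> nat) \<Rightarrow> nat \<Rightarrow> 'u \<Rightarrow> nat" where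
  "latent_D_group R n i \<omega> = card (R 0 (latent_K_group R n i \<omega>) \<omega>)"

definition latent_D :: "nat \<Rightarrow> (nat \<Rightarrow> nat \<Rightarrow> 'u \<Rightarrow> nat set set) \<Rightarrow> (nat \<Rightarrow> nat) \<Rightarrow> 'u \<Rightarrow> nat" where
  "latent_D I R n \<omega> = card (R 0 (latent_K I R n \<omega>) \<omega>)"

definition distinct_group :: "(nat \<Rightarrow> nat \<Rightarrow> 'w \<Rightarrow> 'x) \<Rightarrow> (nat \<Rightarrow> nat) \<Rightarrow> nat \<Rightarrow> 'w \<Rightarrow> nat" where
  "distinct_group \<xi> n i \<omega> = card {\<xi> i j \<omega> | j. j \<in> {1..n i}}"

definition distinct_total :: "nat \<Rightarrow> (nat \<Rightarrow> nat \<Rightarrow> 'w \<Rightarrow> 'x) \<Rightarrow> (nat \<Rightarrow> nat) \<Rightarrow> 'w \<Rightarrow> nat" where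
  "distinct_total I \<xi> n \<omega> = card {\<xi> i j \<omega> | i j. i \<in> {1..I} \<and> j \<in> {1..n i}}"

(* H0*(d|k): the vector of k i.i.d. draws is the identity on the k-fold product space. *)
definition H_star :: "'x measure \<Rightarrow> nat \<Rightarrow> nat \<Rightarrow> real" where
  "H_star H0 d k = \<P>(\<phi> in (\<Pi>\<^sub>M l\<in>{1..k}. H0). card (\<phi> ` {1..k}) = d)"

definition diffuse :: "'x measure \<Rightarrow> bool" where
  "diffuse H0 \<longleftrightarrow> (\<forall>x. emeasure H0 {x} = 0)"

end

theory Submission imports Defs begin

text \<open>
  Write \<open>p = \<Sum>\<^sub>j w\<^sub>j \<delta>\<^sub>Z\<^sub>j\<close>. Expanding the product and sorting the index functions
  \<open>C \<rightarrow> \<nat>\<close> by the partition \<open>\<sigma>\<close> of \<open>C\<close> into their fibres gives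
  \<open>E[\<Prod>\<^sub>c p(F\<^sub>c)] = \<Sum>\<^sub>\<sigma> q0(\<sigma>) \<Prod>\<^sub>D H0(\<Inter>\<^sub>c F\<^sub>c)\<close>, where \<open>D\<close> ranges over the blocks of
  \<open>\<sigma>\<close> and \<open>c\<close> over \<open>D\<close> in the intersection. Inserted into the definition of an HSSM, with
  \<open>C\<close> the set of all pairs of a group \<open>i\<close> and a block of \<open>\<pi> i\<close>, this shows that the law of
  the array agrees on rectangles, hence everywhere, with a mixture over \<open>(\<pi>, \<sigma>)\<close> of laws under
  which the entries are i.i.d. draws from \<open>H0\<close>, one for each block of \<open>\<sigma>\<close>. Under such a
  component the number of distinct values has law \<open>H_star H0 d |\<sigma>|\<close>, and the mixing weights are
  the joint law of the latent partitions, for which \<open>|\<sigma>|\<close> is the latent cluster number.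
\<close>

section \<open>Set partitions and index functions\<close>

text \<open>Distributivity: a product of finitely many countable sums is one sum over the functions
  that pick an index in each factor. It is Fubini for a finite product of counting measures, which
  is again a counting measure because the index set \<open>nat\<close> is countable.\<close>

lemma prod_nn_integral_count_space:
  fixes a :: "'c \<Rightarrow> nat \<Rightarrow> ennreal"
  assumes "finite C"
  shows "(\<Prod>c\<in>C. \<integral>\<^sup>+j. a c j \<partial>count_space UNIV) =
    (\<integral>\<^sup>+f. (\<Prod>c\<in>C. a c (f c)) \<partial>count_space (C \<rightarrow>\<^sub>E UNIV))"
proof -
  interpret product_sigma_finite "\<lambda>_ :: 'c. count_space (UNIV :: nat set)"
    by (simp add: product_sigma_finite_def sigma_finite_measure_count_space)
  show ?thesis
    using product_nn_integral_prod[OF assms, of a]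
    by (simp add: count_space_PiM_finite[OF assms])
qed

lemma nn_integral_count_space_UN_disjoint:
  fixes g :: "'a \<Rightarrow> ennreal"
  assumes "finite T" "disjoint_family_on A T"
  shows "(\<integral>\<^sup>+x. g x \<partial>count_space (\<Union>t\<in>T. A t)) = (\<Sum>t\<in>T. \<integral>\<^sup>+x. g x \<partial>count_space (A t))"
proof -
  have "g x * indicator (\<Union>t\<in>T. A t) x = (\<Sum>t\<in>T. g x * indicator (A t) x)" for x
    by (simp add: indicator_UN_disjoint[OF assms] sum_distrib_left)
  then show ?thesis
    by (simp add: nn_integral_restrict_space[symmetric] nn_integral_sum
      nn_integral_count_space_indicator[of "\<Union>t\<in>T. A t"]
      nn_integral_count_space_indicator[of "A _"] del: UN_simps)
qed

text \<open>The fibres are indexed by points of \<open>C\<close> instead of values of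
  \<open>f\<close>, so that no empty fibre can appear.\<close>

definition kernel_partition :: "'c set \<Rightarrow> ('c \<Rightarrow> 'b) \<Rightarrow> 'c set set" where
  "kernel_partition C f = (\<lambda>c. {c' \<in> C. f c' = f c}) ` C"

lemma partition_on_kernel_partition: "partition_on C (kernel_partition C f)"
  unfolding kernel_partition_def by (rule partition_onI) (auto simp: disjnt_def)

text \<open>The moments in \<open>SSrp\<close> are indexed by tuples, whereas a partition is
  unordered. An enumeration \<open>Bs\<close> of the blocks bridges the two; \<open>idx c\<close> is
  the position of the block of \<open>c\<close>, unique because blocks are disjoint.\<close>

lemma partition_on_index:
  assumes \<sigma>: "partition_on C \<sigma>" and Bs: "set Bs = \<sigma>" "distinct Bs"
  obtains idx where "\<And>c. c \<in> C \<Longrightarrow> idx c < length Bs \<and> c \<in> Bs ! idx c"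
    "\<And>i c. i < length Bs \<Longrightarrow> c \<in> Bs ! i \<Longrightarrow> idx c = i"
    "\<And>i. i < length Bs \<Longrightarrow> Bs ! i \<noteq> {} \<and> Bs ! i \<subseteq> C"
proof -
  have ex: "\<exists>i. i < length Bs \<and> c \<in> Bs ! i" if "c \<in> C" for c
    using that \<sigma> Bs by (metis UnionE in_set_conv_nth partition_onD1)
  have un: "i = i'" if "i < length Bs" "c \<in> Bs ! i" "i' < length Bs" "c \<in> Bs ! i'" for c i i'
  proof (rule ccontr)
    assume "i \<noteq> i'"
    then have "Bs ! i \<noteq> Bs ! i'" using that Bs by (simp add: nth_eq_iff_index_eq)
    then have "Bs ! i \<inter> Bs ! i' = {}"
      using partition_onD2[OF \<sigma>] that Bs by (metis disjointD nth_mem)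
    then show False using that by auto
  qed
  show ?thesis
  proof (rule that[of "\<lambda>c. THE i. i < length Bs \<and> c \<in> Bs ! i"])
    fix c assume "c \<in> C"
    with ex un have "\<exists>!i. i < length Bs \<and> c \<in> Bs ! i" by blast
    from theI'[OF this] show "(THE i. i < length Bs \<and> c \<in> Bs ! i) < length Bs \<and>
       c \<in> Bs ! (THE i. i < length Bs \<and> c \<in> Bs ! i)" .
  next
    fix i c assume "i < length Bs" "c \<in> Bs ! i"
    then show "(THE i. i < length Bs \<and> c \<in> Bs ! i) = i"
      using un by (intro the_equality) auto
  next
    fix i assume "i < length Bs"
    then have "Bs ! i \<in> \<sigma>" using Bs by auto
    then show "Bs ! i \<noteq> {} \<and> Bs ! i \<subseteq> C"
      using \<sigma> by (auto simp: partition_on_def)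
  qed
qed

text \<open>A function whose fibres are exactly the blocks of \<sigma> amounts to one value per
  block, with different values on different blocks. This is why sums over distinct tuples appear in
  the moment formula.\<close>

lemma bij_betw_distinct_lists_kernel:
  assumes Bs: "set Bs = \<sigma>"
    and idx: "\<And>c. c \<in> C \<Longrightarrow> idx c < length Bs \<and> c \<in> Bs ! idx c"
      "\<And>i c. i < length Bs \<Longrightarrow> c \<in> Bs ! i \<Longrightarrow> idx c = i"
      "\<And>i. i < length Bs \<Longrightarrow> Bs ! i \<noteq> {} \<and> Bs ! i \<subseteq> C"
  shows "bij_betw (\<lambda>js. \<lambda>c\<in>C. js ! idx c) {js. length js = length Bs \<and> distinct js}
    {f \<in> C \<rightarrow>\<^sub>E UNIV. kernel_partition C f = \<sigma>}"
  unfolding bij_betw_def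
proof
  \<comment> \<open>A representative of each block: a function constant on blocks is recovered from
    its values at these points.\<close>
  define r where "r i = (SOME c. c \<in> Bs ! i)" for i
  have r: "r i \<in> Bs ! i" "r i \<in> C" "idx (r i) = i" if "i < length Bs" for i
  proof -
    show *: "r i \<in> Bs ! i" unfolding r_def using idx(3)[OF that] by (simp add: some_in_eq)
    show "r i \<in> C" using idx(3)[OF that] * by auto
    show "idx (r i) = i" using idx(2)[OF that *] .
  qed
  let ?J = "{js. length js = length Bs \<and> distinct js}"
  let ?g = "\<lambda>js. \<lambda>c\<in>C. js ! idx c"
  show "inj_on ?g ?J"
  proof (rule inj_onI)
    fix js js' assume js: "js \<in> ?J" "js' \<in> ?J" and eq: "?g js = ?g js'"
    show "js = js'"
    proof (rule nth_equalityI)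
      show "length js = length js'" using js by simp
      fix i assume "i < length js"
      then have "i < length Bs" using js by simp
      from r[OF this] fun_cong[OF eq, of "r i"] show "js ! i = js' ! i" by simp
    qed
  qed
  show "?g ` ?J = {f \<in> C \<rightarrow>\<^sub>E UNIV. kernel_partition C f = \<sigma>}"
  proof (intro set_eqI iffI)
    fix f assume "f \<in> ?g ` ?J"
    then obtain js where js: "length js = length Bs" "distinct js" and f: "f = ?g js" by auto
    have "{c' \<in> C. f c' = f c} = Bs ! idx c" if "c \<in> C" for c
    proof -
      have "js ! idx c' = js ! idx c \<longleftrightarrow> c' \<in> Bs ! idx c" if "c' \<in> C" for c'
        using idx(1)[OF that] idx(1)[OF \<open>c \<in> C\<close>] idx(2)[of "idx c" c'] js
        by (auto simp: nth_eq_iff_index_eq)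
      moreover have "Bs ! idx c \<subseteq> C" using idx that by blast
      ultimately show ?thesis using that by (auto simp: f)
    qed
    then have "kernel_partition C f = (\<lambda>c. Bs ! idx c) ` C"
      unfolding kernel_partition_def by auto
    also have "\<dots> = set Bs"
    proof
      show "(\<lambda>c. Bs ! idx c) ` C \<subseteq> set Bs" using idx by auto
      show "set Bs \<subseteq> (\<lambda>c. Bs ! idx c) ` C"
      proof
        fix B assume "B \<in> set Bs"
        then obtain i where "i < length Bs" "B = Bs ! i" by (auto simp: in_set_conv_nth)
        with r[of i] show "B \<in> (\<lambda>c. Bs ! idx c) ` C" by (intro image_eqI[of _ _ "r i"]) auto
      qed
    qed
    finally show "f \<in> {f \<in> C \<rightarrow>\<^sub>E UNIV. kernel_partition C f = \<sigma>}" using Bs f by auto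
  next
    fix f assume "f \<in> {f \<in> C \<rightarrow>\<^sub>E UNIV. kernel_partition C f = \<sigma>}"
    then have f: "f \<in> C \<rightarrow>\<^sub>E UNIV" and ker: "kernel_partition C f = \<sigma>" by auto
    have blk: "{c' \<in> C. f c' = f c} = Bs ! idx c" if "c \<in> C" for c
    proof -
      have "{c' \<in> C. f c' = f c} \<in> set Bs" using ker Bs that by (auto simp: kernel_partition_def)
      then obtain i where i: "i < length Bs" "{c' \<in> C. f c' = f c} = Bs ! i"
        by (metis in_set_conv_nth)
      moreover have "c \<in> Bs ! i" using i that by auto
      ultimately show ?thesis using idx(2) by metis
    qed
    have key: "f c = f c' \<longleftrightarrow> idx c = idx c'" if "c \<in> C" "c' \<in> C" for c c'
      using blk[OF that(1)] blk[OF that(2)] that idx by (metis (mono_tags, lifting) mem_Collect_eq)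
    define js where "js = map (\<lambda>i. f (r i)) [0..<length Bs]"
    have "js \<in> ?J"
      using key r by (auto simp: js_def distinct_map inj_on_def)
    moreover have "f = ?g js"
    proof
      fix c
      have "f (r (idx c)) = f c" if "c \<in> C"
        using idx(1)[OF that] r[of "idx c"] key that by blast
      then show "f c = ?g js c"
        using f idx by (cases "c \<in> C") (auto simp: js_def)
    qed
    ultimately show "f \<in> ?g ` ?J" by blast
  qed
qed

section \<open>Independence, infinite sums and products over blocks\<close>

text \<open>\<open>SSrp\<close> states independence for the sigma-algebras generated by two maps
  into different spaces. Composing with \<open>f\<close> and \<open>g\<close> gives variables of one
  common type that generate smaller sigma-algebras, so independence survives and the product rule
  for expectations applies.\<close>

lemma (in prob_space) nn_integral_indep_set_mult:
  fixes f :: "'b \<Rightarrow> ennreal" and g :: "'c \<Rightarrow> ennreal"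
  assumes indep: "indep_set (sets (vimage_algebra (space M) X A)) (sets (vimage_algebra (space M) Y B))"
    and [measurable]: "X \<in> measurable M A" "Y \<in> measurable M B"
      "f \<in> borel_measurable A" "g \<in> borel_measurable B"
  shows "(\<integral>\<^sup>+\<omega>. f (X \<omega>) * g (Y \<omega>) \<partial>M) = (\<integral>\<^sup>+\<omega>. f (X \<omega>) \<partial>M) * (\<integral>\<^sup>+\<omega>. g (Y \<omega>) \<partial>M)"
proof -
  have sub: "sigma_sets (space M) {(\<lambda>\<omega>. h (U \<omega>)) -` D \<inter> space M | D. D \<in> sets borel}
      \<subseteq> sets (vimage_algebra (space M) U L)"
    if [measurable]: "U \<in> measurable M L" "h \<in> borel_measurable L" for U L and h :: "_ \<Rightarrow> ennreal"
  proof -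
    have "(\<lambda>\<omega>. h (U \<omega>)) \<in> borel_measurable (vimage_algebra (space M) U L)"
      using measurable_space[OF that(1)]
      by (intro measurable_compose[OF measurable_vimage_algebra1]) auto
    then have "{(\<lambda>\<omega>. h (U \<omega>)) -` D \<inter> space M | D. D \<in> sets borel} \<subseteq> sets (vimage_algebra (space M) U L)"
      by (auto dest: measurable_sets)
    from sets.sigma_sets_subset[OF this] show ?thesis by simp
  qed
  have "indep_var borel (\<lambda>\<omega>. f (X \<omega>)) borel (\<lambda>\<omega>. g (Y \<omega>))"
    unfolding indep_var_eq indep_set_def
  proof (intro conjI)
    show "indep_sets (case_bool
        (sigma_sets (space M) {(\<lambda>\<omega>. f (X \<omega>)) -` A \<inter> space M |A. A \<in> sets borel})
        (sigma_sets (space M) {(\<lambda>\<omega>. g (Y \<omega>)) -` A \<inter> space M |A. A \<in> sets borel})) UNIV"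
      by (rule indep_sets_mono_sets[OF indep[unfolded indep_set_def]])
        (simp add: sub split: bool.split)
  qed simp_all
  moreover have "case_bool borel borel = (\<lambda>_. borel :: ennreal measure)" by (auto split: bool.split)
  ultimately have iv: "indep_vars (\<lambda>_. borel) (case_bool (\<lambda>\<omega>. f (X \<omega>)) (\<lambda>\<omega>. g (Y \<omega>))) UNIV"
    unfolding indep_var_def by simp
  show ?thesis
    using indep_vars_nn_integral[OF _ iv] by (simp add: UNIV_bool mult.commute)
qed

lemma indep_vars_distr_prob_Ball:
  assumes "prob_space N" "prob_space.indep_vars N (\<lambda>_. borel) Z UNIV"
    and distr: "\<And>j :: nat. distr N borel (Z j) = H0"
    and "finite J" "\<And>j. j \<in> J \<Longrightarrow> G j \<in> sets borel"
  shows "emeasure N {\<omega> \<in> space N. \<forall>j\<in>J. Z j \<omega> \<in> G j} = (\<Prod>j\<in>J. emeasure H0 (G j))"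
\<comment> \<open>The product rule \<open>indep_varsD\<close> asks for a nonempty index set, so the
  empty one is treated apart.\<close>
proof (cases "J = {}")
  interpret prob_space N by fact
  case False
  have [measurable]: "Z j \<in> borel_measurable N" for j
    using assms(2) by (simp add: indep_vars_def)
  have "prob (\<Inter>j\<in>J. Z j -` G j \<inter> space N) = (\<Prod>j\<in>J. prob (Z j -` G j \<inter> space N))"
    using assms False by (intro indep_varsD[where M'="\<lambda>_. borel"]) auto
  moreover have "(\<Inter>j\<in>J. Z j -` G j \<inter> space N) = {\<omega> \<in> space N. \<forall>j\<in>J. Z j \<omega> \<in> G j}"
    using False by auto
  moreover have "emeasure H0 (G j) = ennreal (prob (Z j -` G j \<inter> space N))" if "j \<in> J" for j
    using that assms by (simp add: distr[of j, symmetric] emeasure_distr emeasure_eq_measure)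
  ultimately show ?thesis
    by (simp add: emeasure_eq_measure prod_ennreal)
next
  case True
  with assms(1) show ?thesis by (simp add: prob_space.emeasure_space_1)
qed

text \<open>Carries the series that defines \<open>q0\<close> over to extended nonnegative
  integrals. For nonnegative terms summability is absolute, which is integrability for the counting
  measure.\<close>

lemma nn_integral_count_space_has_sum:
  fixes f :: "'a \<Rightarrow> real"
  assumes "(f has_sum s) A" "\<And>x. x \<in> A \<Longrightarrow> 0 \<le> f x"
  shows "(\<integral>\<^sup>+x. ennreal (f x) \<partial>count_space A) = ennreal s"
proof -
  have "f summable_on A" using assms(1) by (rule has_sum_imp_summable)
  then have "(\<lambda>x. norm (f x)) summable_on A"
    using assms(2) by (simp cong: summable_on_cong)
  then have "integrable (count_space A) f"
    unfolding Infinite_Set_Sum.abs_summable_on_def[symmetric] by (simp only: abs_summable_equivalent)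
  then show ?thesis
    using assms by (simp add: Infinite_Set_Sum.abs_summable_on_def nn_integral_conv_infsetsum infsetsum_infsum infsumI)
qed

lemma prod_partition_list:
  fixes h :: "'c \<Rightarrow> 'b :: comm_monoid_mult"
  assumes "finite C" "partition_on C \<sigma>" "set Bs = \<sigma>" "distinct Bs"
  shows "(\<Prod>B\<in>\<sigma>. g B) = (\<Prod>i<length Bs. g (Bs ! i))"
    and "(\<Prod>c\<in>C. h c) = (\<Prod>i<length Bs. \<Prod>c\<in>Bs ! i. h c)"
proof -
  have bij: "bij_betw ((!) Bs) {..<length Bs} \<sigma>"
    using assms by (intro bij_betw_nth) auto
  show *: "(\<Prod>B\<in>\<sigma>. g B) = (\<Prod>i<length Bs. g (Bs ! i))" for g :: "_ \<Rightarrow> 'd :: comm_monoid_mult"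
    by (rule prod.reindex_bij_betw[OF bij, symmetric])
  show "(\<Prod>c\<in>C. h c) = (\<Prod>i<length Bs. \<Prod>c\<in>Bs ! i. h c)"
    using prod.partition[OF assms(1,2), of h] prod.reindex_bij_betw[OF bij, of "\<lambda>B. prod h B"] by simp
qed

section \<open>Mixed moments of a species sampling random probability\<close>

text \<open>The computation runs in \<open>ennreal\<close>, where expectation and infinite sums
  commute freely. For an index function with fibres \<sigma>, atoms and weights separate by
  independence. The atoms give the product over blocks, since different blocks carry different and
  hence independent atoms; the weights, summed over all functions with these fibres, give
  \<open>q0\<close>.\<close>

lemma SSrp_moment:
  fixes H0 :: "'x::polish_space measure" and C :: "'c set" and N :: "'v measure"
  assumes "SSrp q0 H0 N p" and C: "finite C" "C \<noteq> {}"
    and F: "\<And>c. c \<in> C \<Longrightarrow> F c \<in> sets borel"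
  shows "(\<integral>\<^sup>+\<omega>. (\<Prod>c\<in>C. ennreal (measure (p \<omega>) (F c))) \<partial>N) =
    (\<Sum>\<sigma> | partition_on C \<sigma>. ennreal (q0 (image_mset card (mset_set \<sigma>))) *
       (\<Prod>D\<in>\<sigma>. emeasure H0 (\<Inter>c\<in>D. F c)))"
proof -
  interpret prob_space N using assms(1) by (simp add: SSrp_def)
  from assms(1) obtain w :: "nat \<Rightarrow> 'v \<Rightarrow> real" and Z :: "nat \<Rightarrow> 'v \<Rightarrow> 'x" where
    w[measurable]: "\<And>j. w j \<in> borel_measurable N"
    and w1: "AE \<omega> in N. (\<forall>j. 0 \<le> w j \<omega>) \<and> (\<lambda>j. w j \<omega>) sums 1"
    and Z: "indep_vars (\<lambda>_. borel) Z UNIV" "\<And>j. distr N borel (Z j) = H0"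
    and ind: "indep_set
          (sets (vimage_algebra (space N) (\<lambda>\<omega> j. Z j \<omega>) (\<Pi>\<^sub>M j\<in>UNIV. borel)))
          (sets (vimage_algebra (space N) (\<lambda>\<omega> j. w j \<omega>) (\<Pi>\<^sub>M j\<in>UNIV. borel)))"
    and p: "AE \<omega> in N. \<forall>A\<in>sets borel.
           (\<lambda>j. w j \<omega> * measure (return borel (Z j \<omega>)) A) sums measure (p \<omega>) A"
    and q0: "\<And>ns. ns \<noteq> [] \<and> (\<forall>m\<in>set ns. 1 \<le> m) \<Longrightarrow>
           ((\<lambda>js. \<integral>\<omega>. (\<Prod>i<length ns. w (js ! i) \<omega> ^ (ns ! i)) \<partial>N) has_sum q0 (mset ns))
             {js. length js = length ns \<and> distinct js}"
    unfolding SSrp_def by blast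
  have [measurable]: "Z j \<in> borel_measurable N" for j
    using Z(1) by (simp add: indep_vars_def)
  \<comment> \<open>The upper bound makes monomials in the weights integrable, so that the Bochner
    integrals behind \<open>q0\<close> agree with nonnegative ones.\<close>
  have w01: "AE \<omega> in N. \<forall>j. 0 \<le> w j \<omega> \<and> w j \<omega> \<le> 1"
    using w1
  proof eventually_elim
    case (elim \<omega>)
    have "w j \<omega> \<le> 1" for j
      using sum_le_suminf[of "\<lambda>j. w j \<omega>" "{j}"] elim by (auto simp: sums_iff)
    with elim show ?case by auto
  qed
  \<comment> \<open>An index function \<open>f\<close> chooses an atom for each factor
    \<open>c\<close>: \<open>?W f\<close> is the product of the chosen weights, and
    \<open>?G f\<close> is the event that every chosen atom lies in its set.\<close>
  let ?P = "C \<rightarrow>\<^sub>E (UNIV :: nat set)"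
  let ?W = "\<lambda>f \<omega>. \<Prod>c\<in>C. ennreal (w (f c) \<omega>)"
  let ?G = "\<lambda>f. {\<omega> \<in> space N. \<forall>c\<in>C. Z (f c) \<omega> \<in> F c}"
  have [measurable]: "?G f \<in> sets N" for f
    using F C by measurable
  have "(\<integral>\<^sup>+\<omega>. (\<Prod>c\<in>C. ennreal (measure (p \<omega>) (F c))) \<partial>N) =
     (\<integral>\<^sup>+\<omega>. (\<integral>\<^sup>+f. ?W f \<omega> * indicator (?G f) \<omega> \<partial>count_space ?P) \<partial>N)"
  proof (rule nn_integral_cong_AE)
    show "AE \<omega> in N. (\<Prod>c\<in>C. ennreal (measure (p \<omega>) (F c))) =
       (\<integral>\<^sup>+f. ?W f \<omega> * indicator (?G f) \<omega> \<partial>count_space ?P)"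
      using w01 p AE_space
    proof eventually_elim
      case (elim \<omega>)
      have "ennreal (measure (p \<omega>) (F c)) =
        (\<integral>\<^sup>+j. ennreal (w j \<omega>) * indicator (F c) (Z j \<omega>) \<partial>count_space UNIV)" if "c \<in> C" for c
      proof -
        have "(\<lambda>j. w j \<omega> * indicator (F c) (Z j \<omega>)) sums measure (p \<omega>) (F c)"
          using elim F[OF that] by (auto simp: measure_return)
        then have "(\<Sum>j. ennreal (w j \<omega> * indicator (F c) (Z j \<omega>))) = ennreal (measure (p \<omega>) (F c))"
          using elim by (intro suminf_ennreal_eq) auto
        then show ?thesis
          using elim by (simp add: nn_integral_count_space_nat ennreal_mult ennreal_indicator)
      qed
      then have "(\<Prod>c\<in>C. ennreal (measure (p \<omega>) (F c))) =
        (\<integral>\<^sup>+f. (\<Prod>c\<in>C. ennreal (w (f c) \<omega>) * indicator (F c) (Z (f c) \<omega>)) \<partial>count_space ?P)"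
        using prod_nn_integral_count_space[OF C(1), of "\<lambda>c j. ennreal (w j \<omega>) * indicator (F c) (Z j \<omega>)"]
        by simp
      also have "\<dots> = (\<integral>\<^sup>+f. ?W f \<omega> * indicator (?G f) \<omega> \<partial>count_space ?P)"
      proof (rule nn_integral_cong)
        fix f
        have "(\<Prod>c\<in>C. indicator (F c) (Z (f c) \<omega>) :: ennreal) = indicator (?G f) \<omega>"
          using elim C by (auto simp: indicator_def prod_zero_iff)
        then show "(\<Prod>c\<in>C. ennreal (w (f c) \<omega>) * indicator (F c) (Z (f c) \<omega>)) = ?W f \<omega> * indicator (?G f) \<omega>"
          by (simp add: prod.distrib)
      qed
      finally show ?case .
    qed
  qed
  \<comment> \<open>As \<open>C\<close> is finite there are only countably many index functions,
    which justifies the exchange.\<close>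
  also have "\<dots> = (\<integral>\<^sup>+f. (\<integral>\<^sup>+\<omega>. ?W f \<omega> * indicator (?G f) \<omega> \<partial>N) \<partial>count_space ?P)"
    using C(1) by (intro nn_integral_count_space_nn_integral countable_PiE) auto
  also have "\<dots> = (\<integral>\<^sup>+f. (\<integral>\<^sup>+\<omega>. ?W f \<omega> \<partial>N) * emeasure N (?G f) \<partial>count_space ?P)"
  proof (rule nn_integral_cong)
    fix f
    \<comment> \<open>\<open>?G f\<close> becomes the preimage of a cylinder in the sequence space
      of atoms, the form in which independence from the weights is available.\<close>
    define A where "A = {z \<in> space (\<Pi>\<^sub>M j\<in>(UNIV :: nat set). (borel :: 'x measure)). \<forall>c\<in>C. z (f c) \<in> F c}"
    have [measurable]: "A \<in> sets (\<Pi>\<^sub>M j\<in>(UNIV :: nat set). (borel :: 'x measure))"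
      unfolding A_def using F C by measurable
    have "(\<integral>\<^sup>+\<omega>. indicator A (\<lambda>j. Z j \<omega>) * (\<Prod>c\<in>C. ennreal (w (f c) \<omega>)) \<partial>N) =
      (\<integral>\<^sup>+\<omega>. indicator A (\<lambda>j. Z j \<omega>) \<partial>N) * (\<integral>\<^sup>+\<omega>. (\<Prod>c\<in>C. ennreal (w (f c) \<omega>)) \<partial>N)"
      by (rule nn_integral_indep_set_mult[OF ind, of "indicator A" "\<lambda>x. \<Prod>c\<in>C. ennreal (x (f c))"])
        (auto intro!: measurable_PiM_single')
    moreover have "(\<integral>\<^sup>+\<omega>. indicator A (\<lambda>j. Z j \<omega>) \<partial>N) = emeasure N (?G f)"
    proof -
      have "(\<integral>\<^sup>+\<omega>. indicator A (\<lambda>j. Z j \<omega>) \<partial>N) = (\<integral>\<^sup>+\<omega>. indicator (?G f) \<omega> \<partial>N)"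
        by (auto intro!: nn_integral_cong simp: A_def space_PiM indicator_def)
      then show ?thesis by simp
    qed
    moreover have "(\<integral>\<^sup>+\<omega>. indicator A (\<lambda>j. Z j \<omega>) * (\<Prod>c\<in>C. ennreal (w (f c) \<omega>)) \<partial>N) =
      (\<integral>\<^sup>+\<omega>. ?W f \<omega> * indicator (?G f) \<omega> \<partial>N)"
      by (auto intro!: nn_integral_cong simp: A_def space_PiM indicator_def)
    ultimately show "(\<integral>\<^sup>+\<omega>. ?W f \<omega> * indicator (?G f) \<omega> \<partial>N) = (\<integral>\<^sup>+\<omega>. ?W f \<omega> \<partial>N) * emeasure N (?G f)"
      by (simp add: mult.commute)
  qed
  also have "\<dots> = (\<integral>\<^sup>+f. (\<integral>\<^sup>+\<omega>. ?W f \<omega> \<partial>N) * emeasure N (?G f) \<partial>count_space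
     (\<Union>\<sigma>\<in>{\<sigma>. partition_on C \<sigma>}. {f \<in> ?P. kernel_partition C f = \<sigma>}))"
    by (rule arg_cong[where f="\<lambda>X. nn_integral (count_space X) _"])
      (auto simp: partition_on_kernel_partition)
  also have "\<dots> = (\<Sum>\<sigma> | partition_on C \<sigma>. \<integral>\<^sup>+f. (\<integral>\<^sup>+\<omega>. ?W f \<omega> \<partial>N) * emeasure N (?G f)
     \<partial>count_space {f \<in> ?P. kernel_partition C f = \<sigma>})"
    by (rule nn_integral_count_space_UN_disjoint)
      (auto simp: finitely_many_partition_on[OF C(1)] disjoint_family_on_def)
  also have "\<dots> = (\<Sum>\<sigma> | partition_on C \<sigma>. ennreal (q0 (image_mset card (mset_set \<sigma>))) *
       (\<Prod>D\<in>\<sigma>. emeasure H0 (\<Inter>c\<in>D. F c)))"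
  proof (rule sum.cong[OF refl], simp only: mem_Collect_eq)
    fix \<sigma> assume \<sigma>: "partition_on C \<sigma>"
    then obtain Bs where Bs: "set Bs = \<sigma>" "distinct Bs"
      using finite_elements[OF C(1)] finite_distinct_list by blast
    obtain idx where idx: "\<And>c. c \<in> C \<Longrightarrow> idx c < length Bs \<and> c \<in> Bs ! idx c"
      "\<And>i c. i < length Bs \<Longrightarrow> c \<in> Bs ! i \<Longrightarrow> idx c = i"
      "\<And>i. i < length Bs \<Longrightarrow> Bs ! i \<noteq> {} \<and> Bs ! i \<subseteq> C"
      by (rule partition_on_index[OF \<sigma> Bs]) (rule that; blast)
    define ns where "ns = map card Bs"
    have fin: "finite (Bs ! i)" if "i < length Bs" for i
      using idx(3)[OF that] C(1) finite_subset by blast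
    have ns: "ns \<noteq> [] \<and> (\<forall>m\<in>set ns. 1 \<le> m)"
    proof
      have "\<sigma> \<noteq> {}" using \<sigma> C(2) by (auto simp: partition_on_def)
      then show "ns \<noteq> []" using Bs by (auto simp: ns_def)
      show "\<forall>m\<in>set ns. 1 \<le> m"
        using fin idx(3) by (auto simp: ns_def in_set_conv_nth Suc_le_eq card_gt_0_iff)
    qed
    have mset: "mset ns = image_mset card (mset_set \<sigma>)"
      using Bs mset_set_set[OF Bs(2)] by (simp add: ns_def)
    define h where "h = (\<lambda>js. \<integral>\<omega>. (\<Prod>i<length ns. w (js ! i) \<omega> ^ (ns ! i)) \<partial>N)"
    let ?J = "{js :: nat list. length js = length Bs \<and> distinct js}"
    let ?g = "\<lambda>js. \<lambda>c\<in>C. js ! idx c"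
    have idx': "idx c = i" "c \<in> C" if "i < length Bs" "c \<in> Bs ! i" for i c
      using idx(2)[OF that] idx(3)[OF that(1)] that by auto
    have h0: "0 \<le> h js" for js
      unfolding h_def using w01 by (intro integral_nonneg_AE) (auto intro!: prod_nonneg)
    \<comment> \<open>All weights chosen on one block coincide, so block \<open>Bs ! i\<close>
      contributes a power whose exponent is its size \<open>ns ! i\<close>.\<close>
    have W: "(\<integral>\<^sup>+\<omega>. ?W (?g js) \<omega> \<partial>N) = ennreal (h js)" for js
    proof -
      have "(\<integral>\<^sup>+\<omega>. ?W (?g js) \<omega> \<partial>N) = (\<integral>\<^sup>+\<omega>. ennreal (\<Prod>i<length ns. w (js ! i) \<omega> ^ (ns ! i)) \<partial>N)"
      proof (rule nn_integral_cong_AE)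
        show "AE \<omega> in N. ?W (?g js) \<omega> = ennreal (\<Prod>i<length ns. w (js ! i) \<omega> ^ (ns ! i))"
          using w01
        proof eventually_elim
          case (elim \<omega>)
          have "?W (?g js) \<omega> = (\<Prod>i<length Bs. \<Prod>c\<in>Bs ! i. ennreal (w (?g js c) \<omega>))"
            by (rule prod_partition_list(2)[OF C(1) \<sigma> Bs])
          also have "\<dots> = (\<Prod>i<length Bs. \<Prod>c\<in>Bs ! i. ennreal (w (js ! i) \<omega>))"
            using idx' by (intro prod.cong refl) auto
          also have "\<dots> = ennreal (\<Prod>i<length ns. w (js ! i) \<omega> ^ (ns ! i))"
            using elim by (simp add: ns_def prod_ennreal ennreal_power)
          finally show ?case .
        qed
      qed
      also have "\<dots> = ennreal (h js)"
        unfolding h_def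
      proof (rule nn_integral_eq_integral)
        show "integrable N (\<lambda>\<omega>. \<Prod>i<length ns. w (js ! i) \<omega> ^ ns ! i)"
        proof (rule integrable_const_bound[where B=1])
          show "AE \<omega> in N. norm (\<Prod>i<length ns. w (js ! i) \<omega> ^ ns ! i) \<le> 1"
            using w01 by eventually_elim (auto simp: abs_prod power_abs intro!: prod_le_1 power_le_one)
        qed measurable
        show "AE \<omega> in N. 0 \<le> (\<Prod>i<length ns. w (js ! i) \<omega> ^ ns ! i)"
          using w01 by eventually_elim (auto intro!: prod_nonneg)
      qed
      finally show ?thesis .
    qed
    have G: "emeasure N (?G (?g js)) = (\<Prod>D\<in>\<sigma>. emeasure H0 (\<Inter>c\<in>D. F c))" if js: "js \<in> ?J" for js
    proof -
      \<comment> \<open>Distinctness of \<open>js\<close> attaches each index \<open>j\<close> in it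
        to a single block; the atom \<open>Z j\<close> has to lie in all the sets of that
        block.\<close>
      let ?T = "\<lambda>j. \<Inter>c\<in>Bs ! (THE i. i < length Bs \<and> js ! i = j). F c"
      have THE: "(THE i. i < length Bs \<and> js ! i = js ! k) = k" if "k < length Bs" for k
        using that js by (intro the_equality) (auto simp: nth_eq_iff_index_eq)
      have "?G (?g js) = {\<omega> \<in> space N. \<forall>j\<in>set js. Z j \<omega> \<in> ?T j}"
      proof (intro Collect_cong conj_cong refl)
        fix \<omega>
        have "(\<forall>j\<in>set js. Z j \<omega> \<in> ?T j) \<longleftrightarrow> (\<forall>i<length Bs. \<forall>c\<in>Bs ! i. Z (js ! i) \<omega> \<in> F c)"
          using js THE by (auto simp: all_set_conv_all_nth)
        also have "\<dots> \<longleftrightarrow> (\<forall>c\<in>C. Z (?g js c) \<omega> \<in> F c)"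
        proof (intro iffI ballI allI impI)
          fix c assume "\<forall>i<length Bs. \<forall>c\<in>Bs ! i. Z (js ! i) \<omega> \<in> F c" "c \<in> C"
          with idx(1)[of c] show "Z (?g js c) \<omega> \<in> F c" by auto
        next
          fix i c assume "\<forall>c\<in>C. Z (?g js c) \<omega> \<in> F c" "i < length Bs" "c \<in> Bs ! i"
          with idx'[of i c] show "Z (js ! i) \<omega> \<in> F c" by auto
        qed
        finally show "(\<forall>c\<in>C. Z (?g js c) \<omega> \<in> F c) \<longleftrightarrow> (\<forall>j\<in>set js. Z j \<omega> \<in> ?T j)" by simp
      qed
      then have "emeasure N (?G (?g js)) = emeasure N {\<omega> \<in> space N. \<forall>j\<in>set js. Z j \<omega> \<in> ?T j}"
        by (rule arg_cong)
      also have "\<dots> = (\<Prod>j\<in>set js. emeasure H0 (?T j))"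
      proof (rule indep_vars_distr_prob_Ball[OF prob_space_axioms Z])
        fix j assume "j \<in> set js"
        then obtain k where k: "k < length Bs" "j = js ! k" using js by (auto simp: in_set_conv_nth)
        show "?T j \<in> sets borel"
          unfolding k(2) THE[OF k(1)] using idx(3)[OF k(1)] fin[OF k(1)] F
          by (intro sets.finite_INT) auto
      qed simp
      also have "\<dots> = (\<Prod>i<length Bs. emeasure H0 (?T (js ! i)))"
        using js by (intro prod.reindex_bij_betw[symmetric] bij_betw_nth) auto
      also have "\<dots> = (\<Prod>i<length Bs. emeasure H0 (\<Inter>c\<in>Bs ! i. F c))"
        using THE by (intro prod.cong) auto
      also have "\<dots> = (\<Prod>D\<in>\<sigma>. emeasure H0 (\<Inter>c\<in>D. F c))"
        by (rule prod_partition_list(1)[OF C(1) \<sigma> Bs, symmetric])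
      finally show ?thesis .
    qed
    \<comment> \<open>After reparametrization by distinct tuples the atom factor no longer depends
      on the tuple and can be pulled out; what remains is the defining series of
      \<open>q0\<close>.\<close>
    have "(\<integral>\<^sup>+f. (\<integral>\<^sup>+\<omega>. ?W f \<omega> \<partial>N) * emeasure N (?G f) \<partial>count_space {f \<in> ?P. kernel_partition C f = \<sigma>}) =
      (\<integral>\<^sup>+js. (\<integral>\<^sup>+\<omega>. ?W (?g js) \<omega> \<partial>N) * emeasure N (?G (?g js)) \<partial>count_space ?J)"
      by (rule nn_integral_bij_count_space[OF bij_betw_distinct_lists_kernel[OF Bs(1) idx], symmetric])
    also have "\<dots> = (\<integral>\<^sup>+js. ennreal (h js) * (\<Prod>D\<in>\<sigma>. emeasure H0 (\<Inter>c\<in>D. F c)) \<partial>count_space ?J)"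
      by (intro nn_integral_cong arg_cong2[where f="(*)"] W G) simp
    also have "\<dots> = (\<integral>\<^sup>+js. ennreal (h js) \<partial>count_space ?J) * (\<Prod>D\<in>\<sigma>. emeasure H0 (\<Inter>c\<in>D. F c))"
      by (rule nn_integral_multc) simp
    also have "(\<integral>\<^sup>+js. ennreal (h js) \<partial>count_space ?J) = ennreal (q0 (image_mset card (mset_set \<sigma>)))"
      using q0[OF ns] h0 unfolding mset h_def[symmetric]
      by (intro nn_integral_count_space_has_sum) (simp_all add: ns_def)
    finally show "(\<integral>\<^sup>+f. (\<integral>\<^sup>+\<omega>. ?W f \<omega> \<partial>N) * emeasure N (?G f) \<partial>count_space {f \<in> ?P. kernel_partition C f = \<sigma>}) =
      ennreal (q0 (image_mset card (mset_set \<sigma>))) * (\<Prod>D\<in>\<sigma>. emeasure H0 (\<Inter>c\<in>D. F c))" .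
  qed
  finally show ?thesis .
qed

text \<open>A sum of moments of nonnegative weights. The sign matters because \<open>ennreal\<close>
  sends negative reals to 0, so the return to real numbers depends on it.\<close>

lemma SSrp_q0_nonneg:
  assumes "SSrp q0 H0 N p" "finite C" "C \<noteq> {}" "partition_on C \<sigma>"
  shows "0 \<le> q0 (image_mset card (mset_set \<sigma>))"
proof -
  obtain ns where ns: "mset ns = image_mset card (mset_set \<sigma>)" using ex_mset by blast
  have fin: "finite \<sigma>" using finite_elements[OF assms(2,4)] .
  have "\<sigma> \<noteq> {}" using assms by (auto simp: partition_on_def)
  then have 1: "ns \<noteq> []" using ns fin by (auto simp: mset_set_empty_iff)
  have "set ns = card ` \<sigma>" using arg_cong[OF ns, of set_mset] fin by simp
  moreover have "1 \<le> card B" if "B \<in> \<sigma>" for B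
  proof -
    have "B \<noteq> {}" "B \<subseteq> C" using that assms(4) by (auto simp: partition_on_def)
    then show ?thesis using assms(2) by (simp add: Suc_le_eq card_gt_0_iff finite_subset)
  qed
  ultimately have "\<forall>m\<in>set ns. 1 \<le> m" by auto
  with 1 assms(1) obtain w :: "nat \<Rightarrow> 'b \<Rightarrow> real" where
    w: "AE \<omega> in N. (\<forall>j. 0 \<le> w j \<omega>) \<and> (\<lambda>j. w j \<omega>) sums 1"
    and hs: "((\<lambda>js. \<integral>\<omega>. (\<Prod>i<length ns. w (js ! i) \<omega> ^ (ns ! i)) \<partial>N) has_sum q0 (mset ns))
             {js. length js = length ns \<and> distinct js}"
    unfolding SSrp_def by blast
  have "0 \<le> (\<integral>\<omega>. (\<Prod>i<length ns. w (js ! i) \<omega> ^ (ns ! i)) \<partial>N)" for js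
    using w by (intro integral_nonneg_AE) (auto intro!: prod_nonneg)
  with hs have "0 \<le> q0 (mset ns)" by (rule has_sum_nonneg)
  then show ?thesis using ns by simp
qed

text \<open>The moment formula in the real-valued form that matches the integrals in
  \<open>HSSM\<close>.\<close>

lemma SSrp_integral_prod:
  fixes H0 :: "'x::polish_space measure" and C :: "'c set" and N :: "'v measure"
  assumes "SSrp q0 H0 N p" "prob_space H0" and C: "finite C" "C \<noteq> {}"
    and F: "\<And>c. c \<in> C \<Longrightarrow> F c \<in> sets borel"
  shows "(\<integral>\<omega>. (\<Prod>c\<in>C. measure (p \<omega>) (F c)) \<partial>N) =
    (\<Sum>\<sigma> | partition_on C \<sigma>. q0 (image_mset card (mset_set \<sigma>)) *
       (\<Prod>D\<in>\<sigma>. measure H0 (\<Inter>c\<in>D. F c)))"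
proof -
  interpret H0: prob_space H0 by fact
  have p[measurable]: "p \<in> measurable N (subprob_algebra borel)"
    using assms(1) by (auto simp: SSrp_def intro: measurable_prob_algebraD)
  have [measurable]: "(\<lambda>\<omega>. measure (p \<omega>) (F c)) \<in> borel_measurable N" if "c \<in> C" for c
    using measurable_compose[OF p measurable_measure_subprob_algebra[OF F[OF that]]] by simp
  have nn: "0 \<le> q0 (image_mset card (mset_set \<sigma>))" if "partition_on C \<sigma>" for \<sigma>
    using SSrp_q0_nonneg[OF assms(1) C that] .
  have "(\<integral>\<omega>. (\<Prod>c\<in>C. measure (p \<omega>) (F c)) \<partial>N) =
    enn2real (\<integral>\<^sup>+\<omega>. ennreal (\<Prod>c\<in>C. measure (p \<omega>) (F c)) \<partial>N)"
    by (rule integral_eq_nn_integral) (auto intro!: prod_nonneg borel_measurable_prod)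
  also have "\<dots> = enn2real (\<integral>\<^sup>+\<omega>. (\<Prod>c\<in>C. ennreal (measure (p \<omega>) (F c))) \<partial>N)"
    by (simp add: prod_ennreal)
  also have "\<dots> = enn2real (\<Sum>\<sigma> | partition_on C \<sigma>. ennreal (q0 (image_mset card (mset_set \<sigma>))) *
       (\<Prod>D\<in>\<sigma>. emeasure H0 (\<Inter>c\<in>D. F c)))"
    by (subst SSrp_moment[OF assms(1) C F]) auto
  also have "\<dots> = enn2real (ennreal (\<Sum>\<sigma> | partition_on C \<sigma>. q0 (image_mset card (mset_set \<sigma>)) *
       (\<Prod>D\<in>\<sigma>. measure H0 (\<Inter>c\<in>D. F c))))"
    using nn
    by (subst sum_ennreal[symmetric])
      (auto intro!: mult_nonneg_nonneg prod_nonneg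
        simp: H0.emeasure_eq_measure prod_ennreal ennreal_mult'[symmetric])
  also have "\<dots> = (\<Sum>\<sigma> | partition_on C \<sigma>. q0 (image_mset card (mset_set \<sigma>)) *
       (\<Prod>D\<in>\<sigma>. measure H0 (\<Inter>c\<in>D. F c)))"
    using nn by (intro enn2real_ennreal sum_nonneg) (auto intro!: prod_nonneg mult_nonneg_nonneg)
  finally show ?thesis .
qed

section \<open>The number of distinct values in an i.i.d. sample\<close>

text \<open>A further coordinate raises the count by 1 exactly when it agrees with no earlier one,
  and agreement of two measurable maps is an event in a second countable Hausdorff space.\<close>

lemma measurable_card_image:
  fixes f :: "'j \<Rightarrow> 'w \<Rightarrow> 'x :: {second_countable_topology, t2_space}"
  assumes "finite J" "\<And>j. j \<in> J \<Longrightarrow> f j \<in> borel_measurable M"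
  shows "(\<lambda>\<omega>. card ((\<lambda>j. f j \<omega>) ` J)) \<in> measurable M (count_space UNIV)"
  using assms
proof (induction J rule: finite_induct)
  case (insert a J)
  note [measurable] = insert.prems insert.IH[OF insert.prems]
  have eq: "card ((\<lambda>j. f j \<omega>) ` insert a J) =
      card ((\<lambda>j. f j \<omega>) ` J) + (if \<exists>j\<in>J. f j \<omega> = f a \<omega> then 0 else 1)" for \<omega>
  proof -
    have "f a \<omega> \<in> (\<lambda>j. f j \<omega>) ` J \<longleftrightarrow> (\<exists>j\<in>J. f j \<omega> = f a \<omega>)" by (metis imageE image_eqI)
    then show ?thesis using insert.hyps by (simp add: card_insert_if)
  qed
  have [measurable]: "Measurable.pred M (\<lambda>\<omega>. \<exists>j\<in>J. f j \<omega> = f a \<omega>)"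
  proof -
    have "Measurable.pred M (\<lambda>\<omega>. f j \<omega> = f a \<omega>)" if "j \<in> J" for j
      unfolding pred_def using that insert.prems by (intro measurable_equality_set) auto
    then show ?thesis using insert.hyps by (intro pred_intros_finite) auto
  qed
  have [measurable]: "(\<lambda>\<omega>. card ((\<lambda>j. f j \<omega>) ` J)) \<in> measurable M (count_space UNIV)"
    using insert by auto
  show ?case unfolding eq by measurable
qed simp

text \<open>Dynkin's lemma: rectangles are stable under intersection and generate the product
  sigma-algebra. Comparing numbers event by event avoids building the mixture as a measure, so
  \<open>a\<close> may take any real values.\<close>

lemma mixture_eq_on_PiM:
  fixes \<mu> :: "('j \<Rightarrow> 'x) measure"
  assumes "prob_space \<mu>" and s\<mu>: "sets \<mu> = sets (\<Pi>\<^sub>M j\<in>J. L)"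
    and "\<And>t. t \<in> T \<Longrightarrow> prob_space (\<nu> t)" and s\<nu>: "\<And>t. t \<in> T \<Longrightarrow> sets (\<nu> t) = sets (\<Pi>\<^sub>M j\<in>J. L)"
    and "finite J"
    and rect: "\<And>A. (\<And>j. j \<in> J \<Longrightarrow> A j \<in> sets L) \<Longrightarrow>
      measure \<mu> (Pi\<^sub>E J A) = (\<Sum>t\<in>T. a t * measure (\<nu> t) (Pi\<^sub>E J A))"
    and E: "E \<in> sets (\<Pi>\<^sub>M j\<in>J. L)"
  shows "measure \<mu> E = (\<Sum>t\<in>T. a t * measure (\<nu> t) E)"
proof -
  interpret \<mu>: prob_space \<mu> by fact
  let ?O = "\<Pi>\<^sub>E j\<in>J. space L"
  let ?G = "{Pi\<^sub>E J A | A. \<forall>j\<in>J. A j \<in> sets L}"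
  have spm: "space \<mu> = ?O" using sets_eq_imp_space_eq[OF s\<mu>] by (simp add: space_PiM)
  have spn: "space (\<nu> t) = ?O" if "t \<in> T" for t
    using sets_eq_imp_space_eq[OF s\<nu>[OF that]] by (simp add: space_PiM)
  have G: "sets (\<Pi>\<^sub>M j\<in>J. L) = sigma_sets ?O ?G"
    unfolding sets_PiM prod_algebra_eq_finite[OF \<open>finite J\<close>]
    by (rule arg_cong2[where f=sigma_sets]) (auto simp: Pi_iff)
  \<comment> \<open>The whole space is itself a rectangle; the complement step subtracts from
    it.\<close>
  have top: "measure \<mu> ?O = (\<Sum>t\<in>T. a t * measure (\<nu> t) ?O)"
    by (rule rect) auto
  have "?G \<subseteq> Pow ?O"
    by (auto dest: sets.sets_into_space)
  from Int_stable_PiE this E[unfolded G] show ?thesis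
  proof (induction rule: sigma_sets_induct_disjoint)
    case (basic E)
    then obtain A where "E = Pi\<^sub>E J A" "\<And>j. j \<in> J \<Longrightarrow> A j \<in> sets L" by auto
    then show ?case using rect by simp
  next
    case empty
    show ?case by simp
  next
    case (compl E)
    have "measure \<mu> (?O - E) = measure \<mu> ?O - measure \<mu> E"
      using \<mu>.finite_measure_compl[of E] compl s\<mu> G spm by simp
    moreover have "measure (\<nu> t) (?O - E) = measure (\<nu> t) ?O - measure (\<nu> t) E" if "t \<in> T" for t
      using finite_measure.finite_measure_compl[of "\<nu> t" E] compl s\<nu>[OF that] G spn[OF that]
        prob_space.finite_measure[OF assms(3)[OF that]] by simp
    ultimately show ?case
      using compl(2) top by (simp add: right_diff_distrib sum_subtractf)
  next
    case (union A)
    have "(\<lambda>i. measure \<mu> (A i)) sums measure \<mu> (\<Union>i. A i)"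
      using union s\<mu> G by (intro \<mu>.finite_measure_UNION) auto
    moreover have "(\<lambda>i. \<Sum>t\<in>T. a t * measure (\<nu> t) (A i)) sums (\<Sum>t\<in>T. a t * measure (\<nu> t) (\<Union>i. A i))"
      using union s\<nu> G
      by (intro sums_sum sums_mult finite_measure.finite_measure_UNION prob_space.finite_measure assms(3)) auto
    ultimately show ?case
      using union(3) sums_unique2 by simp
  qed
qed

lemma sets_PiM_card_image:
  fixes H0 :: "'x::polish_space measure"
  assumes "sets H0 = sets borel" "finite J"
  shows "{\<phi> \<in> space (\<Pi>\<^sub>M x\<in>J. H0). card (\<phi> ` J) = d} \<in> sets (\<Pi>\<^sub>M x\<in>J. H0)"
proof -
  have "(\<lambda>\<phi>. card ((\<lambda>l. \<phi> l) ` J)) \<in> measurable (\<Pi>\<^sub>M x\<in>J. H0) (count_space UNIV)"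
    using assms by (intro measurable_card_image) (auto simp: measurable_cong_sets[OF refl assms(1)[symmetric]])
  from measurable_sets[OF this, of "{d}"] show ?thesis
    by (simp add: vimage_def Int_def conj_commute)
qed

text \<open>The draws used below are indexed by blocks. Renaming the indices of an i.i.d. family
  along a bijection changes neither its law nor the set of its values, so only the number of indices
  matters.\<close>

lemma H_star_eq_prob_PiM:
  fixes H0 :: "'x::polish_space measure"
  assumes "prob_space H0" "sets H0 = sets borel" "finite X"
  shows "\<P>(\<phi> in (\<Pi>\<^sub>M x\<in>X. H0). card (\<phi> ` X) = d) = H_star H0 d (card X)"
proof -
  obtain f where f: "bij_betw f {1..card X} X"
    using ex_bij_betw_nat_finite_1[OF \<open>finite X\<close>] by auto
  let ?r = "\<lambda>\<omega>. \<lambda>l\<in>{1..card X}. \<omega> (f l)"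
  let ?L = "\<Pi>\<^sub>M l\<in>{1..card X}. H0"
  have [measurable]: "{\<phi> \<in> space ?L. card (\<phi> ` {1..card X}) = d} \<in> sets ?L"
    using assms(2) by (intro sets_PiM_card_image) auto
  have f': "f l \<in> X" if "l \<in> {1..card X}" for l using bij_betw_apply[OF f that] .
  have rm: "?r \<in> measurable (\<Pi>\<^sub>M x\<in>X. H0) ?L"
    using f' by (intro measurable_restrict measurable_component_singleton) auto
  have "distr (\<Pi>\<^sub>M x\<in>X. H0) ?L ?r = ?L"
    using f' f assms(1) by (intro distr_PiM_reindex) (auto simp: bij_betw_def)
  then have "H_star H0 d (card X) = measure (distr (\<Pi>\<^sub>M x\<in>X. H0) ?L ?r) {\<phi> \<in> space ?L. card (\<phi> ` {1..card X}) = d}"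
    by (simp add: H_star_def)
  also have "\<dots> = measure (\<Pi>\<^sub>M x\<in>X. H0) (?r -` {\<phi> \<in> space ?L. card (\<phi> ` {1..card X}) = d} \<inter> space (\<Pi>\<^sub>M x\<in>X. H0))"
    by (rule measure_distr[OF rm]) measurable
  also have "?r -` {\<phi> \<in> space ?L. card (\<phi> ` {1..card X}) = d} \<inter> space (\<Pi>\<^sub>M x\<in>X. H0) =
      {\<phi> \<in> space (\<Pi>\<^sub>M x\<in>X. H0). card (\<phi> ` X) = d}"
  proof -
    have "(\<lambda>l. \<phi> (f l)) ` {1..card X} = \<phi> ` X" for \<phi> :: "'a \<Rightarrow> 'x"
      using f by (metis bij_betw_def image_image)
    then show ?thesis using measurable_space[OF rm] by (auto simp del: One_nat_def)
  qed
  finally show ?thesis by simp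
qed

lemma H_star_eq_0:
  assumes "k < d" shows "H_star H0 d k = 0"
proof -
  have "card (\<phi> ` {1..k}) \<noteq> d" for \<phi> :: "nat \<Rightarrow> 'a"
    using card_image_le[of "{1..k}" \<phi>] assms by auto
  then show ?thesis by (simp add: H_star_def)
qed

section \<open>Samples from a diffuse law\<close>

text \<open>Induction on the index set with Fubini: given distinct earlier coordinates, the new one
  only has to avoid their finitely many values, a null set for a diffuse measure.\<close>

lemma AE_PiM_diffuse_inj_on:
  fixes H0 :: "'x::polish_space measure"
  assumes "prob_space H0" "sets H0 = sets borel" "diffuse H0" "finite J"
  shows "AE \<phi> in (\<Pi>\<^sub>M x\<in>J. H0). inj_on \<phi> J"
  using assms(4)
proof (induction J rule: finite_induct)
  case (insert i J)
  interpret prob_space H0 by fact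
  interpret product_sigma_finite "\<lambda>_. H0"
    by (simp add: product_sigma_finite_def sigma_finite_measure_axioms)
  let ?L = "\<lambda>J. \<Pi>\<^sub>M x\<in>J. H0"
  have bad: "{\<phi> \<in> space (?L J). \<not> inj_on \<phi> J} \<in> sets (?L J)" if "finite J" for J :: "'a set"
  proof -
    have "{\<phi> \<in> space (?L J). \<not> inj_on \<phi> J} = space (?L J) - {\<phi> \<in> space (?L J). card (\<phi> ` J) = card J}"
      using that by (auto simp: inj_on_iff_eq_card)
    then show ?thesis
      using sets_PiM_card_image[OF assms(2) that] by (simp add: sets.compl_sets)
  qed
  let ?B = "{\<phi> \<in> space (?L (insert i J)). \<not> inj_on \<phi> (insert i J)}"
  have B: "?B \<in> sets (?L (insert i J))" using insert.hyps by (intro bad) simp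
  have "emeasure (?L (insert i J)) ?B = (\<integral>\<^sup>+\<phi>. indicator ?B \<phi> \<partial>?L (insert i J))"
    by (rule nn_integral_indicator[symmetric]) fact
  also have "\<dots> = (\<integral>\<^sup>+x. (\<integral>\<^sup>+y. indicator ?B (x(i := y)) \<partial>H0) \<partial>?L J)"
    using insert.hyps B by (intro product_nn_integral_insert borel_measurable_indicator) auto
  also have "\<dots> = (\<integral>\<^sup>+x. 0 \<partial>?L J)"
  proof (rule nn_integral_cong_AE)
    show "AE x in ?L J. (\<integral>\<^sup>+y. indicator ?B (x(i := y)) \<partial>H0) = 0"
      using insert.IH
    proof eventually_elim
      case (elim x)
      have null: "x ` J \<in> null_sets H0"
      proof -
        have "(\<Union>j\<in>J. {x j}) \<in> null_sets H0"
          using insert.hyps assms(2,3) by (intro null_sets.finite_UN) (auto simp: diffuse_def null_sets_def)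
        moreover have "(\<Union>j\<in>J. {x j}) = x ` J" by auto
        ultimately show ?thesis by simp
      qed
      have "(\<integral>\<^sup>+y. indicator ?B (x(i := y)) \<partial>H0) = (\<integral>\<^sup>+y. 0 \<partial>H0)"
      proof (rule nn_integral_cong_AE)
        show "AE y in H0. indicator ?B (x(i := y)) = (0::ennreal)"
          using AE_not_in[OF null]
        proof eventually_elim
          case (elim y)
          have "inj_on (x(i := y)) (insert i J)"
            using elim \<open>inj_on x J\<close> insert.hyps by (auto simp: inj_on_def)
          then show ?case by (simp add: indicator_def)
        qed
      qed
      then show ?case by simp
    qed
  qed
  finally have "?B \<in> null_sets (?L (insert i J))" using B by (simp add: null_sets_def)
  from AE_not_in[OF this] show ?case by (auto elim: AE_mp)
qed simp

text \<open>Almost surely all \<open>k\<close> draws differ, so the count is the constant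
  \<open>k\<close>.\<close>

lemma H_star_diffuse:
  fixes H0 :: "'x::polish_space measure"
  assumes "prob_space H0" "sets H0 = sets borel" "diffuse H0"
  shows "H_star H0 d k = (if k = d then 1 else 0)"
proof -
  interpret product_prob_space "\<lambda>_. H0" "{1..k}"
    using assms(1) by (simp add: product_prob_space_def product_prob_space_axioms_def
      product_sigma_finite_def prob_space_imp_sigma_finite)
  have "AE \<phi> in (\<Pi>\<^sub>M l\<in>{1..k}. H0). card (\<phi> ` {1..k}) = k"
    using AE_PiM_diffuse_inj_on[OF assms, of "{1..k}", OF finite_atLeastAtMost] by eventually_elim (auto simp: card_image)
  then have "AE \<phi> in (\<Pi>\<^sub>M l\<in>{1..k}. H0). card (\<phi> ` {1..k}) = d \<longleftrightarrow> k = d" by eventually_elim auto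
  then have "\<P>(\<phi> in (\<Pi>\<^sub>M l\<in>{1..k}. H0). card (\<phi> ` {1..k}) = d) =
    \<P>(\<phi> in (\<Pi>\<^sub>M l\<in>{1..k}. H0). k = d)"
    using sets_PiM_card_image[OF assms(2), of "{1..k}" d]
    by (intro P.prob_eq_AE) (auto simp del: One_nat_def)
  then show ?thesis
    using P.prob_space by (auto simp: H_star_def simp del: One_nat_def)
qed

section \<open>The number of distinct values in a hierarchical sample\<close>

definition block_of :: "'c set set \<Rightarrow> 'c \<Rightarrow> 'c set" where
  "block_of \<sigma> x = (THE D. D \<in> \<sigma> \<and> x \<in> D)"

lemma block_of_eq:
  assumes "partition_on C \<sigma>" "D \<in> \<sigma>" "x \<in> D"
  shows "block_of \<sigma> x = D"
  unfolding block_of_def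
proof (rule the_equality)
  fix D' assume "D' \<in> \<sigma> \<and> x \<in> D'"
  then show "D' = D"
    using assms disjointD[OF partition_onD2[OF assms(1)], of D D'] by blast
qed (use assms in auto)

lemma block_of:
  assumes "partition_on C \<sigma>" "x \<in> C"
  shows "block_of \<sigma> x \<in> \<sigma>" "x \<in> block_of \<sigma> x"
proof -
  obtain D where "D \<in> \<sigma>" "x \<in> D" using assms by (auto simp: partition_on_def)
  with block_of_eq[OF assms(1) this] show "block_of \<sigma> x \<in> \<sigma>" "x \<in> block_of \<sigma> x" by auto
qed

text \<open>The map \<open>b\<close> composes two clusterings: \<open>(i, j)\<close> goes to its
  block in group \<open>i\<close>, and this block to its block in \<sigma>. It is onto because
  blocks are nonempty, so as many draws are used as \<sigma> has blocks. The second claim collects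
  the constraints on all observations that share a draw.\<close>

lemma partition_index_block_of:
  assumes "finite S" and \<pi>: "\<And>i. i \<in> S \<Longrightarrow> partition_on {1..n i} (\<pi> i)"
    and \<sigma>: "partition_on (Sigma S \<pi>) \<sigma>"
  defines "J \<equiv> Sigma S (\<lambda>i. {1..n i :: nat})" and "b \<equiv> \<lambda>(i, j). block_of \<sigma> (i, block_of (\<pi> i) j)"
  shows "b ` J = \<sigma>"
    and "(\<forall>x\<in>J. \<phi> (b x) \<in> A x) \<longleftrightarrow> (\<forall>D\<in>\<sigma>. \<phi> D \<in> (\<Inter>(i, B)\<in>D. \<Inter>j\<in>B. A (i, j)))"
proof -
  have bin: "b (i, j) \<in> \<sigma>" "(i, block_of (\<pi> i) j) \<in> b (i, j)" "j \<in> block_of (\<pi> i) j"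
    if "(i, j) \<in> J" for i j
    using that block_of[OF \<pi>, of i j] block_of[OF \<sigma>, of "(i, block_of (\<pi> i) j)"]
    by (auto simp: J_def b_def)
  have beq: "b (i, j) = D" "(i, j) \<in> J" if "D \<in> \<sigma>" "(i, B) \<in> D" "j \<in> B" for i j B D
  proof -
    have iB: "i \<in> S" "B \<in> \<pi> i" using that \<sigma> by (auto simp: partition_on_def)
    then have "block_of (\<pi> i) j = B" using block_of_eq[OF \<pi>] that by blast
    then show "b (i, j) = D" using block_of_eq[OF \<sigma>] that by (simp add: b_def)
    show "(i, j) \<in> J" using \<pi>[OF iB(1)] iB that by (auto simp: J_def partition_on_def)
  qed
  show "b ` J = \<sigma>"
  proof
    show "b ` J \<subseteq> \<sigma>" using bin by force
    show "\<sigma> \<subseteq> b ` J"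
    proof
      fix D assume D: "D \<in> \<sigma>"
      then obtain i B where iB: "(i, B) \<in> D"
        using partition_onD3[OF \<sigma>] by (metis ex_in_conv surj_pair)
      then have "i \<in> S" "B \<in> \<pi> i" using D \<sigma> by (auto simp: partition_on_def)
      then obtain j where "j \<in> B"
        using partition_onD3[OF \<pi>[of i]] by (metis ex_in_conv)
      from beq[OF D iB this] show "D \<in> b ` J" by (metis imageI)
    qed
  qed
  show "(\<forall>x\<in>J. \<phi> (b x) \<in> A x) \<longleftrightarrow> (\<forall>D\<in>\<sigma>. \<phi> D \<in> (\<Inter>(i, B)\<in>D. \<Inter>j\<in>B. A (i, j)))"
  proof (intro iffI ballI)
    fix D assume *: "\<forall>x\<in>J. \<phi> (b x) \<in> A x" and D: "D \<in> \<sigma>"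
    have "\<phi> D \<in> A (i, j)" if "(i, B) \<in> D" "j \<in> B" for i B j
      using * beq[OF D that] by force
    then show "\<phi> D \<in> (\<Inter>(i, B)\<in>D. \<Inter>j\<in>B. A (i, j))" by auto
  next
    fix x assume *: "\<forall>D\<in>\<sigma>. \<phi> D \<in> (\<Inter>(i, B)\<in>D. \<Inter>j\<in>B. A (i, j))" and x: "x \<in> J"
    obtain i j where [simp]: "x = (i, j)" by force
    from bin[of i j] x * show "\<phi> (b x) \<in> A x" by fastforce
  qed
qed

lemma measure_PiM_Ball:
  assumes "prob_space H0" "finite X" "\<And>x. x \<in> X \<Longrightarrow> G x \<in> sets H0"
  shows "measure (\<Pi>\<^sub>M x\<in>X. H0) {\<phi> \<in> space (\<Pi>\<^sub>M x\<in>X. H0). \<forall>x\<in>X. \<phi> x \<in> G x} = (\<Prod>x\<in>X. measure H0 (G x))"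
proof -
  interpret H0: prob_space H0 by fact
  interpret product_prob_space "\<lambda>_. H0" X
    by unfold_locales
  have "ennreal (measure (\<Pi>\<^sub>M x\<in>X. H0) {\<phi> \<in> space (\<Pi>\<^sub>M x\<in>X. H0). \<forall>x\<in>X. \<phi> x \<in> G x}) =
      ennreal (\<Prod>x\<in>X. measure H0 (G x))"
    using emeasure_PiM_Collect[of X G] assms
    by (simp add: P.emeasure_eq_measure H0.emeasure_eq_measure prod_ennreal)
  then show ?thesis by (simp add: prod_nonneg)
qed

text \<open>Stated for a set \<open>S\<close> of groups and the rectangle formula over
  \<open>S\<close>, so that a single group and the whole array are covered by one argument.\<close>

lemma distinct_values_mixture:
  fixes H0 :: "'x::polish_space measure" and N :: "'v measure" and M :: "'w measure"
    and \<xi> :: "nat \<Rightarrow> nat \<Rightarrow> 'w \<Rightarrow> 'x" and n :: "nat \<Rightarrow> nat"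
  assumes SSrp: "SSrp q0 H0 N p" and H0: "prob_space H0" "sets H0 = sets borel"
    and M: "prob_space M" and S: "finite S" "S \<noteq> {}" and n: "\<And>i. i \<in> S \<Longrightarrow> 1 \<le> n i"
    and \<xi>: "\<And>i j. i \<in> S \<Longrightarrow> j \<in> {1..n i} \<Longrightarrow> \<xi> i j \<in> borel_measurable M"
    and rect: "\<And>A. (\<And>i j. i \<in> S \<Longrightarrow> j \<in> {1..n i} \<Longrightarrow> A i j \<in> sets borel) \<Longrightarrow>
      \<P>(\<omega> in M. \<forall>i\<in>S. \<forall>j\<in>{1..n i}. \<xi> i j \<omega> \<in> A i j) =
      (\<Sum>\<pi>\<in>(\<Pi>\<^sub>E i\<in>S. partitions (n i)). (\<Prod>i\<in>S. at_partition q (\<pi> i)) *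
         (\<integral>\<omega>. (\<Prod>i\<in>S. \<Prod>B\<in>\<pi> i. measure (p \<omega>) (\<Inter>j\<in>B. A i j)) \<partial>N))"
  shows "\<P>(\<omega> in M. card ((\<lambda>(i, j). \<xi> i j \<omega>) ` Sigma S (\<lambda>i. {1..n i})) = d) =
    (\<Sum>\<pi>\<in>(\<Pi>\<^sub>E i\<in>S. partitions (n i)). (\<Prod>i\<in>S. at_partition q (\<pi> i)) *
      (\<Sum>\<sigma> | partition_on (Sigma S \<pi>) \<sigma>. q0 (image_mset card (mset_set \<sigma>)) * H_star H0 d (card \<sigma>)))"
proof -
  interpret M: prob_space M by fact
  define J where "J = Sigma S (\<lambda>i. {1..n i})"
  define PP where "PP = (\<Pi>\<^sub>E i\<in>S. partitions (n i))"
  define T where "T = Sigma PP (\<lambda>\<pi>. {\<sigma>. partition_on (Sigma S \<pi>) \<sigma>})"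
  define X where "X \<omega> = (\<lambda>x\<in>J. \<xi> (fst x) (snd x) \<omega>)" for \<omega>
  define b where "b = (\<lambda>(\<pi> :: nat \<Rightarrow> nat set set) \<sigma> (i, j). block_of \<sigma> (i, block_of (\<pi> i) j))"
  define Y where "Y \<pi> \<sigma> \<phi> = (\<lambda>x\<in>J. \<phi> (b \<pi> \<sigma> x))" for \<pi> \<sigma> and \<phi> :: "(nat \<times> nat set) set \<Rightarrow> 'x"
  let ?L = "\<Pi>\<^sub>M x\<in>J. (borel :: 'x measure)"
  let ?Q = "\<lambda>\<sigma> :: (nat \<times> nat set) set set. \<Pi>\<^sub>M x\<in>\<sigma>. H0"
  let ?qs = "\<lambda>\<sigma> :: (nat \<times> nat set) set set. q0 (image_mset card (mset_set \<sigma>))"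
  \<comment> \<open>\<open>\<nu> (\<pi>, \<sigma>)\<close> is the law of the vector in which every
    observation receives the draw attached to its block of \<sigma>; \<open>a\<close> is the weight
    of the pair in the mixture.\<close>
  define \<nu> where "\<nu> = (\<lambda>(\<pi>, \<sigma>). distr (?Q \<sigma>) ?L (Y \<pi> \<sigma>))"
  define a where "a = (\<lambda>(\<pi>, \<sigma>). (\<Prod>i\<in>S. at_partition q (\<pi> i)) * ?qs \<sigma>)"
  have finJ: "finite J" using S by (simp add: J_def)
  have fin_parts: "finite (partitions m)" for m
    by (simp add: partitions_def finitely_many_partition_on)
  have finPP: "finite PP" using S fin_parts by (simp add: PP_def finite_PiE)
  have \<pi>: "partition_on {1..n i} (\<pi> i)" "finite (\<pi> i)" if "\<pi> \<in> PP" "i \<in> S" for \<pi> i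
    using that finite_elements[of "{1..n i}"] by (auto simp: PP_def partitions_def PiE_def Pi_iff)
  \<comment> \<open>The moment formula is for nonempty index sets; positive group sizes guarantee at
    least one block.\<close>
  have C: "finite (Sigma S \<pi>)" "Sigma S \<pi> \<noteq> {}" if "\<pi> \<in> PP" for \<pi>
  proof -
    show "finite (Sigma S \<pi>)" using S \<pi>[OF that] by auto
    obtain i where i: "i \<in> S" using S by auto
    then have "1 \<in> \<Union>(\<pi> i)" using \<pi>(1)[OF that i] n[OF i] by (simp add: partition_on_def)
    then show "Sigma S \<pi> \<noteq> {}" using i by auto
  qed
  have finpar: "finite {\<sigma>. partition_on (Sigma S \<pi>) \<sigma>}" if "\<pi> \<in> PP" for \<pi>
    using C[OF that] by (simp add: finitely_many_partition_on)
  have T: "\<pi> \<in> PP" "partition_on (Sigma S \<pi>) \<sigma>" "finite \<sigma>" if "(\<pi>, \<sigma>) \<in> T" for \<pi> \<sigma>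
    using that C finite_elements[of "Sigma S \<pi>"] by (auto simp: T_def)
  have b: "b \<pi> \<sigma> ` J = \<sigma>"
      "(\<forall>x\<in>J. \<phi> (b \<pi> \<sigma> x) \<in> A x) \<longleftrightarrow> (\<forall>D\<in>\<sigma>. \<phi> D \<in> (\<Inter>(i, B)\<in>D. \<Inter>j\<in>B. A (i, j)))"
    if "(\<pi>, \<sigma>) \<in> T" for \<pi> \<sigma> and \<phi> :: "(nat \<times> nat set) set \<Rightarrow> 'x" and A
    unfolding J_def b_def
    by (rule partition_index_block_of[OF S(1) \<pi>(1)[OF T(1)[OF that]] T(2)[OF that]]; assumption)+
  have Xm: "X \<in> measurable M ?L"
    unfolding X_def using \<xi> by (intro measurable_restrict) (auto simp: J_def)
  have Ym: "Y \<pi> \<sigma> \<in> measurable (?Q \<sigma>) ?L" if "(\<pi>, \<sigma>) \<in> T" for \<pi> \<sigma>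
    unfolding Y_def
  proof (rule measurable_restrict)
    fix x assume "x \<in> J"
    then have "b \<pi> \<sigma> x \<in> \<sigma>" using b(1)[OF that] by blast
    then have "(\<lambda>\<phi>. \<phi> (b \<pi> \<sigma> x)) \<in> measurable (?Q \<sigma>) H0" by simp
    then show "(\<lambda>\<phi>. \<phi> (b \<pi> \<sigma> x)) \<in> borel_measurable (?Q \<sigma>)"
      by (simp add: measurable_cong_sets[OF refl H0(2)[symmetric]])
  qed
  have Q: "prob_space (?Q \<sigma>)" for \<sigma> using H0(1) by (intro prob_space_PiM)
  have key: "measure (distr M ?L X) E = (\<Sum>t\<in>T. a t * measure (\<nu> t) E)" if "E \<in> sets ?L" for E
  proof (rule mixture_eq_on_PiM[where J=J and L=borel])
    show "prob_space (distr M ?L X)" using Xm by (rule M.prob_space_distr)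
    show "prob_space (\<nu> t)" if "t \<in> T" for t
    proof -
      obtain \<pi> \<sigma> where "t = (\<pi>, \<sigma>)" by force
      then show ?thesis
        using prob_space.prob_space_distr[OF Q Ym[of \<pi> \<sigma>]] that by (simp add: \<nu>_def)
    qed
    show "sets (\<nu> t) = sets ?L" for t by (auto simp: \<nu>_def split: prod.split)
    fix A :: "nat \<times> nat \<Rightarrow> 'x set" assume A: "\<And>x. x \<in> J \<Longrightarrow> A x \<in> sets borel"
    have PA: "Pi\<^sub>E J A \<in> sets ?L" using A finJ by (intro sets_PiM_I_finite) auto
    have X_iff: "X -` Pi\<^sub>E J A \<inter> space M = {\<omega> \<in> space M. \<forall>i\<in>S. \<forall>j\<in>{1..n i}. \<xi> i j \<omega> \<in> A (i, j)}"
      by (auto simp: X_def J_def PiE_iff)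
    \<comment> \<open>Observations in a block \<open>B\<close> of group \<open>i\<close> share one
      value, which must lie in \<open>F (i, B)\<close>. With pairs \<open>(i, B)\<close> as index
      set the double product becomes the single product of the moment formula.\<close>
    define F where "F = (\<lambda>(i :: nat, B). \<Inter>j\<in>B. A (i, j))"
    have Fm: "F c \<in> sets borel" if p: "\<pi> \<in> PP" and cS: "c \<in> Sigma S \<pi>" for \<pi> c
    proof -
      obtain i B where c: "c = (i, B)" "i \<in> S" "B \<in> \<pi> i" using cS by auto
      have "B \<noteq> {}" "B \<subseteq> {1..n i}" using \<pi>(1)[OF p c(2)] c by (auto simp: partition_on_def)
      then show ?thesis
        unfolding c(1) F_def using c(2) A by (auto simp: J_def finite_subset intro!: sets.finite_INT)
    qed
    have "measure (distr M ?L X) (Pi\<^sub>E J A) = \<P>(\<omega> in M. \<forall>i\<in>S. \<forall>j\<in>{1..n i}. \<xi> i j \<omega> \<in> A (i, j))"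
      by (simp only: measure_distr[OF Xm PA] X_iff)
    also have "\<dots> = (\<Sum>\<pi>\<in>PP. (\<Prod>i\<in>S. at_partition q (\<pi> i)) *
         (\<integral>\<omega>. (\<Prod>i\<in>S. \<Prod>B\<in>\<pi> i. measure (p \<omega>) (\<Inter>j\<in>B. A (i, j))) \<partial>N))"
      unfolding PP_def by (rule rect) (use A in \<open>auto simp: J_def\<close>)
    also have "\<dots> = (\<Sum>\<pi>\<in>PP. \<Sum>\<sigma> | partition_on (Sigma S \<pi>) \<sigma>. a (\<pi>, \<sigma>) * measure (\<nu> (\<pi>, \<sigma>)) (Pi\<^sub>E J A))"
    proof (rule sum.cong[OF refl])
      fix \<pi> assume p: "\<pi> \<in> PP"
      have "(\<integral>\<omega>. (\<Prod>i\<in>S. \<Prod>B\<in>\<pi> i. measure (p \<omega>) (\<Inter>j\<in>B. A (i, j))) \<partial>N) =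
        (\<integral>\<omega>. (\<Prod>c\<in>Sigma S \<pi>. measure (p \<omega>) (F c)) \<partial>N)"
        using S \<pi>(2)[OF p] by (subst prod.Sigma) (auto simp: F_def split_def)
      also have "\<dots> = (\<Sum>\<sigma> | partition_on (Sigma S \<pi>) \<sigma>. ?qs \<sigma> * (\<Prod>D\<in>\<sigma>. measure H0 (\<Inter>c\<in>D. F c)))"
        by (rule SSrp_integral_prod[OF SSrp H0(1) C[OF p] Fm[OF p]])
      also have "\<dots> = (\<Sum>\<sigma> | partition_on (Sigma S \<pi>) \<sigma>. ?qs \<sigma> * measure (\<nu> (\<pi>, \<sigma>)) (Pi\<^sub>E J A))"
      proof (intro sum.cong[OF refl] arg_cong2[where f="(*)"] refl)
        fix \<sigma> assume s: "\<sigma> \<in> {\<sigma>. partition_on (Sigma S \<pi>) \<sigma>}"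
        then have t: "(\<pi>, \<sigma>) \<in> T" using p by (simp add: T_def)
        have G: "(\<Inter>c\<in>D. F c) \<in> sets H0" if "D \<in> \<sigma>" for D
        proof -
          have "D \<noteq> {}" "D \<subseteq> Sigma S \<pi>" using that s by (auto simp: partition_on_def)
          then show ?thesis
            unfolding H0(2) using C[OF p] Fm[OF p] by (intro sets.finite_INT) (auto intro: finite_subset)
        qed
        have "measure (\<nu> (\<pi>, \<sigma>)) (Pi\<^sub>E J A) = measure (?Q \<sigma>) (Y \<pi> \<sigma> -` Pi\<^sub>E J A \<inter> space (?Q \<sigma>))"
          by (simp add: \<nu>_def measure_distr[OF Ym[OF t] PA])
        also have "Y \<pi> \<sigma> -` Pi\<^sub>E J A \<inter> space (?Q \<sigma>) = {\<phi> \<in> space (?Q \<sigma>). \<forall>x\<in>J. \<phi> (b \<pi> \<sigma> x) \<in> A x}"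
          by (auto simp: Y_def PiE_iff)
        also have "\<dots> = {\<phi> \<in> space (?Q \<sigma>). \<forall>D\<in>\<sigma>. \<phi> D \<in> (\<Inter>c\<in>D. F c)}"
          unfolding b(2)[OF t] F_def ..
        also have "measure (?Q \<sigma>) \<dots> = (\<Prod>D\<in>\<sigma>. measure H0 (\<Inter>c\<in>D. F c))"
          by (rule measure_PiM_Ball[OF H0(1) T(3)[OF t] G])
        finally show "(\<Prod>D\<in>\<sigma>. measure H0 (\<Inter>c\<in>D. F c)) = measure (\<nu> (\<pi>, \<sigma>)) (Pi\<^sub>E J A)" by simp
      qed
      finally show "(\<Prod>i\<in>S. at_partition q (\<pi> i)) *
         (\<integral>\<omega>. (\<Prod>i\<in>S. \<Prod>B\<in>\<pi> i. measure (p \<omega>) (\<Inter>j\<in>B. A (i, j))) \<partial>N) =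
         (\<Sum>\<sigma> | partition_on (Sigma S \<pi>) \<sigma>. a (\<pi>, \<sigma>) * measure (\<nu> (\<pi>, \<sigma>)) (Pi\<^sub>E J A))"
        by (simp add: a_def sum_distrib_left mult.assoc)
    qed
    also have "\<dots> = (\<Sum>t\<in>T. a t * measure (\<nu> t) (Pi\<^sub>E J A))"
      unfolding T_def using finPP finpar by (subst sum.Sigma) (auto simp: split_def)
    finally show "measure (distr M ?L X) (Pi\<^sub>E J A) = (\<Sum>t\<in>T. a t * measure (\<nu> t) (Pi\<^sub>E J A))" .
  qed (use finJ that in auto)
  define E where "E = {x \<in> space ?L. card (x ` J) = d}"
  have Em: "E \<in> sets ?L" unfolding E_def by (rule sets_PiM_card_image) (auto simp: finJ)
  have "\<P>(\<omega> in M. card ((\<lambda>(i, j). \<xi> i j \<omega>) ` J) = d) = measure (distr M ?L X) E"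
  proof -
    have "X \<omega> ` J = (\<lambda>(i, j). \<xi> i j \<omega>) ` J" for \<omega>
      unfolding X_def by (intro image_cong refl) auto
    then have "X -` E \<inter> space M = {\<omega> \<in> space M. card ((\<lambda>(i, j). \<xi> i j \<omega>) ` J) = d}"
      using measurable_space[OF Xm] by (auto simp: E_def)
    then show ?thesis by (simp add: measure_distr[OF Xm Em])
  qed
  also have "\<dots> = (\<Sum>t\<in>T. a t * measure (\<nu> t) E)" by (rule key[OF Em])
  also have "\<dots> = (\<Sum>\<pi>\<in>PP. \<Sum>\<sigma> | partition_on (Sigma S \<pi>) \<sigma>. a (\<pi>, \<sigma>) * measure (\<nu> (\<pi>, \<sigma>)) E)"
    unfolding T_def using finPP finpar by (subst sum.Sigma) (auto simp: split_def)
  also have "\<dots> = (\<Sum>\<pi>\<in>PP. \<Sum>\<sigma> | partition_on (Sigma S \<pi>) \<sigma>. a (\<pi>, \<sigma>) * H_star H0 d (card \<sigma>))"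
  proof (intro sum.cong[OF refl] arg_cong2[where f="(*)"] refl)
    fix \<pi> \<sigma> assume "\<pi> \<in> PP" "\<sigma> \<in> {\<sigma>. partition_on (Sigma S \<pi>) \<sigma>}"
    then have t: "(\<pi>, \<sigma>) \<in> T" by (simp add: T_def)
    \<comment> \<open>Since \<open>b\<close> maps onto \<sigma>, the values observed are exactly
      those of the draws, without omission.\<close>
    have "Y \<pi> \<sigma> \<phi> ` J = \<phi> ` (b \<pi> \<sigma> ` J)" for \<phi>
      unfolding Y_def image_image by (intro image_cong refl) simp
    then have "Y \<pi> \<sigma> \<phi> ` J = \<phi> ` \<sigma>" for \<phi> by (simp only: b(1)[OF t])
    then have "Y \<pi> \<sigma> -` E \<inter> space (?Q \<sigma>) = {\<phi> \<in> space (?Q \<sigma>). card (\<phi> ` \<sigma>) = d}"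
      using measurable_space[OF Ym[OF t]] by (auto simp: E_def)
    then have "measure (\<nu> (\<pi>, \<sigma>)) E = measure (?Q \<sigma>) {\<phi> \<in> space (?Q \<sigma>). card (\<phi> ` \<sigma>) = d}"
      by (simp add: \<nu>_def measure_distr[OF Ym[OF t] Em])
    then show "measure (\<nu> (\<pi>, \<sigma>)) E = H_star H0 d (card \<sigma>)"
      by (simp add: H_star_eq_prob_PiM[OF H0 T(3)[OF t]])
  qed
  finally show ?thesis
    by (simp add: J_def PP_def a_def sum_distrib_left mult.assoc)
qed

text \<open>In the mixture \<sigma> partitions a set of pairs, while the latent \<open>R 0\<close>
  partitions initial segments of the positive integers. A bijection between the two sets preserves
  block sizes, on which alone the summand depends.\<close>

lemma sum_partition_on_relabel:
  fixes g :: "nat multiset \<Rightarrow> real" and C :: "'c set"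
  assumes "finite C"
  shows "(\<Sum>\<sigma> | partition_on C \<sigma>. g (image_mset card (mset_set \<sigma>))) =
    (\<Sum>\<sigma>\<in>partitions (card C). g (image_mset card (mset_set \<sigma>)))"
proof -
  obtain h where h: "bij_betw h C {1..card C}"
    using ex_bij_betw_nat_finite_1[OF assms] bij_betw_inv by blast
  have img: "partition_on B (((`) f) ` \<sigma>)" if f: "bij_betw f A B" and \<sigma>: "partition_on A \<sigma>"
    for f :: "'p \<Rightarrow> 'q" and A B \<sigma>
  proof -
    have "partition_on (f ` A) ((`) f ` \<sigma> - {{}})"
      using partition_on_inj_image[OF \<sigma>, of f] f by (simp add: bij_betw_def)
    moreover have "{} \<notin> (`) f ` \<sigma>" using partition_onD3[OF \<sigma>] by auto
    ultimately show ?thesis using f by (simp add: bij_betw_def)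
  qed
  let ?h' = "inv_into C h"
  have h': "bij_betw ?h' {1..card C} C" using h by (rule bij_betw_inv_into)
  have "bij_betw ((`) ((`) h)) {\<sigma>. partition_on C \<sigma>} (partitions (card C))"
  proof (rule bij_betw_byWitness[where f'="(`) ((`) ?h')"])
    show "\<forall>\<sigma>\<in>{\<sigma>. partition_on C \<sigma>}. (`) ?h' ` (`) h ` \<sigma> = \<sigma>"
    proof
      fix \<sigma> assume "\<sigma> \<in> {\<sigma>. partition_on C \<sigma>}"
      then have "?h' ` h ` B = B" if "B \<in> \<sigma>" for B
        using that h by (intro inv_into_image_cancel) (auto simp: bij_betw_def partition_on_def)
      then show "(`) ?h' ` (`) h ` \<sigma> = \<sigma>" by (force simp: image_image)
    qed
    show "\<forall>\<sigma>\<in>partitions (card C). (`) h ` (`) ?h' ` \<sigma> = \<sigma>"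
    proof
      fix \<sigma> assume "\<sigma> \<in> partitions (card C)"
      then have "h ` ?h' ` B = B" if "B \<in> \<sigma>" for B
        using that h by (intro image_inv_into_cancel[of _ _ "{1..card C}"])
          (auto simp: bij_betw_def partition_on_def partitions_def)
      then show "(`) h ` (`) ?h' ` \<sigma> = \<sigma>" by (force simp: image_image)
    qed
  qed (use img[OF h] img[OF h'] in \<open>auto simp: partitions_def\<close>)
  from sum.reindex_bij_betw[OF this, of "\<lambda>\<sigma>. g (image_mset card (mset_set \<sigma>))"]
  have "(\<Sum>\<sigma>\<in>partitions (card C). g (image_mset card (mset_set \<sigma>))) =
    (\<Sum>\<sigma> | partition_on C \<sigma>. g (image_mset card (mset_set ((`) h ` \<sigma>))))" by simp
  also have "\<dots> = (\<Sum>\<sigma> | partition_on C \<sigma>. g (image_mset card (mset_set \<sigma>)))"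
  proof (intro sum.cong[OF refl] arg_cong[where f=g])
    fix \<sigma> assume \<sigma>: "\<sigma> \<in> {\<sigma>. partition_on C \<sigma>}"
    then have sub: "B \<subseteq> C" if "B \<in> \<sigma>" for B using that by (auto simp: partition_on_def)
    have inj: "inj_on h C" using h by (simp add: bij_betw_def)
    have "inj_on ((`) h) \<sigma>"
      using inj_on_image_Pow[OF inj] sub by (auto intro: inj_on_subset)
    moreover have "card (h ` B) = card B" if "B \<in> \<sigma>" for B
      using card_image[OF inj_on_subset[OF inj sub[OF that]]] .
    moreover have "finite \<sigma>"
      using \<sigma> finite_elements[OF assms] by auto
    ultimately show "image_mset card (mset_set ((`) h ` \<sigma>)) = image_mset card (mset_set \<sigma>)"
      by (subst image_mset_mset_set[symmetric])
        (auto simp: multiset.map_comp o_def intro!: image_mset_cong)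
  qed
  finally show ?thesis by simp
qed

section \<open>The latent partitions\<close>

lemma finite_partitions: "finite (partitions m)"
  by (simp add: partitions_def finitely_many_partition_on)

lemma card_partitions_le:
  assumes "\<pi> \<in> partitions m" shows "card \<pi> \<le> m"
proof -
  have part: "partition_on {1..m} \<pi>" using assms by (simp add: partitions_def)
  have "inj_on (\<lambda>B. SOME x. x \<in> B) \<pi>"
  proof (rule inj_onI)
    fix B B' assume B: "B \<in> \<pi>" "B' \<in> \<pi>" and eq: "(SOME x. x \<in> B) = (SOME x. x \<in> B')"
    have "B \<noteq> {}" "B' \<noteq> {}" using B part by (auto simp: partition_on_def)
    then have "(SOME x. x \<in> B) \<in> B \<inter> B'" using eq by (metis Int_iff some_in_eq)
    then show "B = B'" using disjointD[OF partition_onD2[OF part] B] by blast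
  qed
  moreover have "(\<lambda>B. SOME x. x \<in> B) ` \<pi> \<subseteq> {1..m}"
  proof clarify
    fix B assume "B \<in> \<pi>"
    then have "B \<noteq> {}" "B \<subseteq> {1..m}" using part by (auto simp: partition_on_def)
    then show "(SOME x. x \<in> B) \<in> {1..m}" using some_in_eq[of B] by blast
  qed
  ultimately show ?thesis using card_inj_on_le[of _ \<pi> "{1..m}"] by simp
qed

lemma card_partitions_ge_1:
  assumes "\<pi> \<in> partitions m" "1 \<le> m" shows "1 \<le> card \<pi>"
proof -
  have "partition_on {1..m} \<pi>" using assms by (simp add: partitions_def)
  then have "\<pi> \<noteq> {}" "finite \<pi>"
    using assms(2) finite_elements[of "{1..m}"] by (auto simp: partition_on_def)
  then show ?thesis by (simp add: Suc_le_eq card_gt_0_iff)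
qed

text \<open>The summands are the point probabilities of \<open>R m\<close>. This sums out the groups
  other than the one under study.\<close>

lemma sum_at_partition_eq_1:
  assumes "has_eppf P R q" "1 \<le> m"
  shows "(\<Sum>\<pi>\<in>partitions m. at_partition q \<pi>) = 1"
proof -
  from assms(1) interpret prob_space P
    by (simp add: has_eppf_def exchangeable_random_partition_def)
  have [measurable]: "R m \<in> measurable P (count_space (partitions m))"
    using assms(1) by (simp add: has_eppf_def exchangeable_random_partition_def)
  have "(\<Sum>\<pi>\<in>partitions m. at_partition q \<pi>) = (\<Sum>\<pi>\<in>partitions m. prob {u \<in> space P. R m u = \<pi>})"
    using assms by (intro sum.cong refl) (simp add: has_eppf_def)
  also have "\<dots> = prob (\<Union>\<pi>\<in>partitions m. {u \<in> space P. R m u = \<pi>})"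
    by (intro finite_measure_finite_Union[symmetric])
      (auto simp: finite_partitions disjoint_family_on_def)
  also have "(\<Union>\<pi>\<in>partitions m. {u \<in> space P. R m u = \<pi>}) = space P"
    using measurable_space[of "R m" P "count_space (partitions m)"] by auto
  finally show ?thesis by (simp add: prob_space)
qed

text \<open>Independence is given for whole sequences of partitions; the cylinder \<open>A i\<close>
  looks at one level of each. The level \<open>K\<close> of \<open>R 0\<close> is a fixed number
  here, the random level being treated afterwards.\<close>

lemma latent_joint_law:
  assumes "latent_partitions I q q0 P R" "S \<subseteq> {1..I}"
    and n: "\<And>i. i \<in> S \<Longrightarrow> 1 \<le> n i" and \<pi>: "\<And>i. i \<in> S \<Longrightarrow> \<pi> i \<in> partitions (n i)"
    and "1 \<le> K" "\<sigma> \<in> partitions K"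
  shows "\<P>(u in P. (\<forall>i\<in>S. R i (n i) u = \<pi> i) \<and> R 0 K u = \<sigma>) =
    (\<Prod>i\<in>S. at_partition q (\<pi> i)) * at_partition q0 \<sigma>"
proof -
  have ep: "has_eppf P (R 0) q0" "\<And>i. i \<in> S \<Longrightarrow> has_eppf P (R i) q"
    using assms by (auto simp: latent_partitions_def)
  from ep(1) interpret prob_space P
    by (simp add: has_eppf_def exchangeable_random_partition_def)
  let ?L = "\<Pi>\<^sub>M n\<in>UNIV. count_space (partitions n)"
  have ind: "indep_vars (\<lambda>_. ?L) (\<lambda>i \<omega> n. R i n \<omega>) {0..I}"
    using assms(1) by (simp add: latent_partitions_def)
  \<comment> \<open>As 0 lies outside \<open>S\<close>, slot 0 is free for the level and value of
    \<open>R 0\<close>, and all partitions form one family over \<open>insert 0 S\<close>.\<close>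
  define m where "m = n(0 := K)"
  define \<tau> where "\<tau> = \<pi>(0 := \<sigma>)"
  define A where "A i = {x \<in> space ?L. x (m i) = \<tau> i}" for i
  have 0: "0 \<notin> S" and fS: "finite S" using assms(2) by (auto intro: finite_subset)
  have \<tau>: "\<tau> i \<in> partitions (m i)" if "i \<in> insert 0 S" for i
    using that assms(6) \<pi> 0 by (auto simp: \<tau>_def m_def)
  have A: "A i \<in> sets ?L" if "i \<in> insert 0 S" for i
  proof -
    have "(\<lambda>x. x (m i)) -` {\<tau> i} \<inter> space ?L \<in> sets ?L"
      using \<tau>[OF that] by (intro measurable_sets[OF measurable_component_singleton[of "m i"]]) auto
    then show ?thesis by (simp add: A_def vimage_def Int_def conj_commute)
  qed
  have sp: "(\<lambda>n. R i n u) \<in> space ?L" if "i \<in> insert 0 S" "u \<in> space P" for i u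
  proof -
    have "random_variable ?L (\<lambda>u n. R i n u)"
      using ind that(1) assms(2) by (auto simp: indep_vars_def)
    from measurable_space[OF this that(2)] show ?thesis .
  qed
  have pre: "(\<lambda>u n. R i n u) -` A i \<inter> space P = {u \<in> space P. R i (m i) u = \<tau> i}" if "i \<in> insert 0 S" for i
    using sp[OF that] by (auto simp: A_def)
  have "prob (\<Inter>i\<in>insert 0 S. (\<lambda>u n. R i n u) -` A i \<inter> space P) =
      (\<Prod>i\<in>insert 0 S. prob ((\<lambda>u n. R i n u) -` A i \<inter> space P))"
    using assms(2) fS A by (intro indep_varsD[OF ind]) auto
  also have "\<dots> = (\<Prod>i\<in>insert 0 S. prob {u \<in> space P. R i (m i) u = \<tau> i})"
    by (intro prod.cong refl arg_cong[where f=prob] pre)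
  also have "\<dots> = prob {u \<in> space P. R 0 K u = \<sigma>} * (\<Prod>i\<in>S. prob {u \<in> space P. R i (n i) u = \<pi> i})"
    using 0 fS by (auto simp: m_def \<tau>_def intro!: arg_cong2[where f="(*)"] prod.cong)
  also have "\<dots> = at_partition q0 \<sigma> * (\<Prod>i\<in>S. at_partition q (\<pi> i))"
    using ep n \<pi> assms(5,6) by (auto simp: has_eppf_def intro!: arg_cong2[where f="(*)"] prod.cong)
  also have "(\<Inter>i\<in>insert 0 S. (\<lambda>u n. R i n u) -` A i \<inter> space P) =
      {u \<in> space P. (\<forall>i\<in>S. R i (n i) u = \<pi> i) \<and> R 0 K u = \<sigma>}"
  proof -
    have "(\<Inter>i\<in>insert 0 S. (\<lambda>u n. R i n u) -` A i \<inter> space P) =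
        (\<Inter>i\<in>insert 0 S. {u \<in> space P. R i (m i) u = \<tau> i})"
      using pre by (intro INF_cong refl)
    also have "\<dots> = {u \<in> space P. (\<forall>i\<in>S. R i (m i) u = \<tau> i) \<and> R 0 (m 0) u = \<tau> 0}"
      by auto
    also have "\<dots> = {u \<in> space P. (\<forall>i\<in>S. R i (n i) u = \<pi> i) \<and> R 0 K u = \<sigma>}"
    proof -
      have "m i = n i" "\<tau> i = \<pi> i" if "i \<in> S" for i using that 0 by (auto simp: m_def \<tau>_def)
      then show ?thesis by (simp add: m_def \<tau>_def cong: ball_cong)
    qed
    finally show ?thesis .
  qed
  finally show ?thesis by (simp add: mult.commute)
qed

text \<open>The difficulty is that \<open>R 0\<close> is evaluated at a random level. On the event
  that the group partitions equal \<pi> this level is the constant \<open>K \<pi>\<close>, so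
  splitting over the finitely many pairs (\<pi>, \<sigma>) reduces everything to the joint law at
  fixed levels.\<close>

lemma sum_prob_latent_blocks:
  assumes lp: "latent_partitions I q q0 P R" and S: "S \<subseteq> {1..I}" "S \<noteq> {}"
    and n: "\<And>i. i \<in> S \<Longrightarrow> 1 \<le> n i"
  defines "D \<equiv> \<lambda>u. card (R 0 (\<Sum>i\<in>S. card (R i (n i) u)) u)"
  shows "(\<Sum>k\<le>sum n S. h k * \<P>(u in P. D u = k)) =
      (\<Sum>\<pi>\<in>(\<Pi>\<^sub>E i\<in>S. partitions (n i)). (\<Prod>i\<in>S. at_partition q (\<pi> i)) *
        (\<Sum>\<sigma>\<in>partitions (\<Sum>i\<in>S. card (\<pi> i)). at_partition q0 \<sigma> * h (card \<sigma>)))"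
    and "u \<in> space P \<Longrightarrow> D u \<le> sum n S"
proof -
  have ep: "has_eppf P (R 0) q0" "\<And>i. i \<in> S \<Longrightarrow> has_eppf P (R i) q"
    using lp S by (auto simp: latent_partitions_def)
  from ep(1) interpret prob_space P
    by (simp add: has_eppf_def exchangeable_random_partition_def)
  have fS: "finite S" using S by (auto intro: finite_subset)
  have R0[measurable]: "R 0 m \<in> measurable P (count_space (partitions m))" for m
    using ep by (auto simp: has_eppf_def exchangeable_random_partition_def)
  have Ri[measurable]: "R i m \<in> measurable P (count_space (partitions m))" if "i \<in> S" for i m
    using ep(2)[OF that] by (auto simp: has_eppf_def exchangeable_random_partition_def)
  have mem0: "R 0 m u \<in> partitions m" if "u \<in> space P" for m u
    using measurable_space[OF R0 that] by simp
  have mem: "R i m u \<in> partitions m" if "u \<in> space P" "i \<in> S" for i m u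
    using measurable_space[OF Ri[OF that(2)] that(1)] by simp
  define PP where "PP = (\<Pi>\<^sub>E i\<in>S. partitions (n i))"
  define K where "K \<pi> = (\<Sum>i\<in>S. card (\<pi> i))" for \<pi> :: "nat \<Rightarrow> nat set set"
  define T where "T = Sigma PP (\<lambda>\<pi>. partitions (K \<pi>))"
  define ev where "ev = (\<lambda>(\<pi>, \<sigma>). {u \<in> space P. (\<forall>i\<in>S. R i (n i) u = \<pi> i) \<and> R 0 (K \<pi>) u = \<sigma>})"
  define a where "a = (\<lambda>(\<pi>, \<sigma>). (\<Prod>i\<in>S. at_partition q (\<pi> i)) * at_partition q0 \<sigma>)"
  have finPP: "finite PP" using fS finite_partitions by (simp add: PP_def finite_PiE)
  have finT: "finite T" using finPP finite_partitions by (simp add: T_def)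
  have PP: "\<pi> i \<in> partitions (n i)" if "\<pi> \<in> PP" "i \<in> S" for \<pi> i
    using that by (auto simp: PP_def)
  \<comment> \<open>\<open>has_eppf\<close> prescribes the law only from level 1 on, hence the lower
    bound.\<close>
  have K1: "1 \<le> K \<pi>" "K \<pi> \<le> sum n S" if "\<pi> \<in> PP" for \<pi>
  proof -
    obtain i where i: "i \<in> S" using S by auto
    have "1 \<le> card (\<pi> i)" using card_partitions_ge_1[OF PP[OF that i] n[OF i]] .
    also have "\<dots> \<le> K \<pi>" unfolding K_def using i fS by (intro member_le_sum) auto
    finally show "1 \<le> K \<pi>" .
    show "K \<pi> \<le> sum n S"
      unfolding K_def using card_partitions_le[OF PP[OF that]] by (intro sum_mono)
  qed
  have prob_ev: "prob (ev t) = a t" if "t \<in> T" for t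
  proof -
    obtain \<pi> \<sigma> where t: "t = (\<pi>, \<sigma>)" "\<pi> \<in> PP" "\<sigma> \<in> partitions (K \<pi>)" using \<open>t \<in> T\<close> by (auto simp: T_def)
    show ?thesis
      unfolding t(1) using latent_joint_law[OF lp S(1) n PP[OF t(2)] K1(1)[OF t(2)] t(3)]
      by (simp add: ev_def a_def)
  qed
  have ev_sets: "ev t \<in> sets P" for t
  proof -
    have "{u \<in> space P. R i (n i) u = x} \<in> sets P" if "i \<in> S" for i x
      using Ri[OF that] by measurable
    then have "{u \<in> space P. \<forall>i\<in>S. R i (n i) u = \<pi> i} \<in> sets P" for \<pi>
      using fS by (intro sets.sets_Collect_finite_All) auto
    then have "{u \<in> space P. (\<forall>i\<in>S. R i (n i) u = \<pi> i) \<and> R 0 (K \<pi>) u = \<sigma>} \<in> sets P" for \<pi> \<sigma>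
      by (intro sets.sets_Collect_conj) measurable
    then show ?thesis by (simp add: ev_def split: prod.split)
  qed
  \<comment> \<open>The pair realized at \<open>u\<close>, made extensional so that it belongs to
    \<open>T\<close>. Hence the events \<open>ev t\<close> cover the space.\<close>
  have inT: "((\<lambda>i\<in>S. R i (n i) u), R 0 (K (\<lambda>i. R i (n i) u)) u) \<in> T"
    and inev: "u \<in> ev ((\<lambda>i\<in>S. R i (n i) u), R 0 (K (\<lambda>i. R i (n i) u)) u)" if "u \<in> space P" for u
  proof -
    have "K (\<lambda>i\<in>S. R i (n i) u) = K (\<lambda>i. R i (n i) u)" by (simp add: K_def)
    then show "((\<lambda>i\<in>S. R i (n i) u), R 0 (K (\<lambda>i. R i (n i) u)) u) \<in> T"
      "u \<in> ev ((\<lambda>i\<in>S. R i (n i) u), R 0 (K (\<lambda>i. R i (n i) u)) u)"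
      using that mem mem0 by (auto simp: T_def PP_def ev_def)
  qed
  have D_ev: "D u = card (snd t)" if "u \<in> ev t" for u t
  proof -
    have "K (fst t) = (\<Sum>i\<in>S. card (R i (n i) u))" using that by (auto simp: ev_def K_def split: prod.splits)
    then show ?thesis using that by (auto simp: ev_def D_def split: prod.splits)
  qed
  have card_T: "card (snd t) \<le> sum n S" if "t \<in> T" for t
    using that card_partitions_le K1(2) by (fastforce simp: T_def)
  show "u \<in> space P \<Longrightarrow> D u \<le> sum n S" using D_ev[OF inev] card_T[OF inT] by simp
  have ev_unique: "t = t'" if t: "t \<in> T" "u \<in> ev t" and t': "t' \<in> T" "u \<in> ev t'" for t t' u
  proof -
    have fst: "fst s = (\<lambda>i\<in>S. R i (n i) u)" if "s \<in> T" "u \<in> ev s" for s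
    proof
      fix i show "fst s i = (\<lambda>i\<in>S. R i (n i) u) i"
        using that by (cases "i \<in> S") (auto simp: T_def PP_def ev_def)
    qed
    have "fst t = fst t'" using fst[OF t] fst[OF t'] by simp
    then show ?thesis using t t' by (auto simp: ev_def split: prod.splits)
  qed
  have disj: "disjoint_family_on ev T'" if "T' \<subseteq> T" for T'
    using ev_unique that unfolding disjoint_family_on_def by blast
  have PD: "\<P>(u in P. D u = k) = (\<Sum>t | t \<in> T \<and> card (snd t) = k. a t)" for k
  proof -
    have "{u \<in> space P. D u = k} = (\<Union>t\<in>{t \<in> T. card (snd t) = k}. ev t)"
    proof (intro set_eqI iffI)
      fix u assume "u \<in> {u \<in> space P. D u = k}"
      then have u: "u \<in> space P" and k: "D u = k" by auto
      show "u \<in> (\<Union>t\<in>{t \<in> T. card (snd t) = k}. ev t)"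
      proof (rule UN_I)
        show "((\<lambda>i\<in>S. R i (n i) u), R 0 (K (\<lambda>i. R i (n i) u)) u) \<in> {t \<in> T. card (snd t) = k}"
          using inT[OF u] D_ev[OF inev[OF u]] k by simp
      qed (rule inev[OF u])
    next
      fix u assume "u \<in> (\<Union>t\<in>{t \<in> T. card (snd t) = k}. ev t)"
      then obtain t where "u \<in> ev t" "card (snd t) = k" by auto
      then show "u \<in> {u \<in> space P. D u = k}"
        using D_ev[of u t] by (auto simp: ev_def split: prod.splits)
    qed
    then have "\<P>(u in P. D u = k) = (\<Sum>t | t \<in> T \<and> card (snd t) = k. prob (ev t))"
      using finT ev_sets disj by (simp add: finite_measure_finite_Union image_subset_iff)
    then show ?thesis using prob_ev by simp
  qed
  have "(\<Sum>k\<le>sum n S. h k * \<P>(u in P. D u = k)) =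
      (\<Sum>k\<le>sum n S. \<Sum>t | t \<in> T \<and> card (snd t) = k. h (card (snd t)) * a t)"
    unfolding PD by (simp add: sum_distrib_left)
  also have "\<dots> = (\<Sum>t\<in>T. h (card (snd t)) * a t)"
    using finT card_T by (intro sum.group) auto
  also have "\<dots> = (\<Sum>\<pi>\<in>PP. \<Sum>\<sigma>\<in>partitions (K \<pi>). h (card \<sigma>) * a (\<pi>, \<sigma>))"
    unfolding T_def using finPP finite_partitions by (subst sum.Sigma) (auto simp: split_def)
  finally show "(\<Sum>k\<le>sum n S. h k * \<P>(u in P. D u = k)) =
      (\<Sum>\<pi>\<in>(\<Pi>\<^sub>E i\<in>S. partitions (n i)). (\<Prod>i\<in>S. at_partition q (\<pi> i)) *
        (\<Sum>\<sigma>\<in>partitions (\<Sum>i\<in>S. card (\<pi> i)). at_partition q0 \<sigma> * h (card \<sigma>)))"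
    by (simp add: PP_def K_def a_def sum_distrib_left mult_ac)
qed

section \<open>Proof of the proposition\<close>

text \<open>Both sides are the same weighted sum of \<open>H_star\<close> over pairs (\<pi>,
  \<sigma>), read once from the law of the array and once from the latent partitions. Only the set
  that \<sigma> partitions has to be relabelled.\<close>

lemma distinct_values_eq_latent_sum:
  fixes H0 :: "'x::polish_space measure" and N :: "'v measure" and M :: "'w measure"
    and \<xi> :: "nat \<Rightarrow> nat \<Rightarrow> 'w \<Rightarrow> 'x" and n :: "nat \<Rightarrow> nat"
  assumes SSrp: "SSrp q0 H0 N p" and H0: "prob_space H0" "sets H0 = sets borel"
    and M: "prob_space M" and lp: "latent_partitions I q q0 P R"
    and S: "S \<subseteq> {1..I}" "S \<noteq> {}" and n: "\<And>i. i \<in> S \<Longrightarrow> 1 \<le> n i"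
    and \<xi>: "\<And>i j. i \<in> S \<Longrightarrow> j \<in> {1..n i} \<Longrightarrow> \<xi> i j \<in> borel_measurable M"
    and rect: "\<And>A. (\<And>i j. i \<in> S \<Longrightarrow> j \<in> {1..n i} \<Longrightarrow> A i j \<in> sets borel) \<Longrightarrow>
      \<P>(\<omega> in M. \<forall>i\<in>S. \<forall>j\<in>{1..n i}. \<xi> i j \<omega> \<in> A i j) =
      (\<Sum>\<pi>\<in>(\<Pi>\<^sub>E i\<in>S. partitions (n i)). (\<Prod>i\<in>S. at_partition q (\<pi> i)) *
         (\<integral>\<omega>. (\<Prod>i\<in>S. \<Prod>B\<in>\<pi> i. measure (p \<omega>) (\<Inter>j\<in>B. A i j)) \<partial>N))"
  shows "\<P>(\<omega> in M. card ((\<lambda>(i, j). \<xi> i j \<omega>) ` Sigma S (\<lambda>i. {1..n i})) = d) =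
    (\<Sum>k\<le>sum n S. H_star H0 d k *
      \<P>(u in P. card (R 0 (\<Sum>i\<in>S. card (R i (n i) u)) u) = k))"
proof -
  have fS: "finite S" using S by (auto intro: finite_subset)
  have "(\<Sum>\<sigma> | partition_on (Sigma S \<pi>) \<sigma>. q0 (image_mset card (mset_set \<sigma>)) * H_star H0 d (card \<sigma>)) =
     (\<Sum>\<sigma>\<in>partitions (\<Sum>i\<in>S. card (\<pi> i)). at_partition q0 \<sigma> * H_star H0 d (card \<sigma>))"
    if \<pi>: "\<pi> \<in> (\<Pi>\<^sub>E i\<in>S. partitions (n i))" for \<pi>
  proof -
    have "finite (\<pi> i)" if "i \<in> S" for i
      using \<pi> that finite_elements[of "{1..n i}"] by (auto simp: partitions_def PiE_iff)
    then have "finite (Sigma S \<pi>)" "card (Sigma S \<pi>) = (\<Sum>i\<in>S. card (\<pi> i))"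
      using fS by (auto simp: card_SigmaI)
    \<comment> \<open>The number of blocks is the size of the multiset of block sizes, so the whole
      summand is a function of that multiset.\<close>
    with sum_partition_on_relabel[of "Sigma S \<pi>" "\<lambda>s. q0 s * H_star H0 d (size s)"]
    show ?thesis by (simp add: at_partition_def)
  qed
  then have "(\<Sum>\<pi>\<in>(\<Pi>\<^sub>E i\<in>S. partitions (n i)). (\<Prod>i\<in>S. at_partition q (\<pi> i)) *
      (\<Sum>\<sigma> | partition_on (Sigma S \<pi>) \<sigma>. q0 (image_mset card (mset_set \<sigma>)) * H_star H0 d (card \<sigma>))) =
    (\<Sum>\<pi>\<in>(\<Pi>\<^sub>E i\<in>S. partitions (n i)). (\<Prod>i\<in>S. at_partition q (\<pi> i)) *
      (\<Sum>\<sigma>\<in>partitions (\<Sum>i\<in>S. card (\<pi> i)). at_partition q0 \<sigma> * H_star H0 d (card \<sigma>)))"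
    by (intro sum.cong refl) simp
  with distinct_values_mixture[OF SSrp H0 M fS S(2) n \<xi> rect, of d]
    sum_prob_latent_blocks(1)[where h = "H_star H0 d", OF lp S n]
  show ?thesis by simp
qed

text \<open>Take all sets outside group \<open>l\<close> to be \<open>UNIV\<close>: the other groups then contribute a factor
  \<open>p(UNIV) = 1\<close>, and their weights sum to 1.\<close>
lemma HSSM_group_rect:
  fixes H0 :: "'x::polish_space measure" and A :: "nat \<Rightarrow> nat \<Rightarrow> 'x set"
  assumes HSSM: "HSSM I q q0 H0 N p M \<xi>" and lp: "latent_partitions I q q0 P R"
    and n: "\<And>i. i \<in> {1..I} \<Longrightarrow> 1 \<le> n i" and l: "l \<in> {1..I}"
    and A: "\<And>j. j \<in> {1..n l} \<Longrightarrow> A l j \<in> sets borel"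
  shows "\<P>(\<omega> in M. \<forall>i\<in>{l}. \<forall>j\<in>{1..n i}. \<xi> i j \<omega> \<in> A i j) =
      (\<Sum>\<pi>\<in>(\<Pi>\<^sub>E i\<in>{l}. partitions (n i)). (\<Prod>i\<in>{l}. at_partition q (\<pi> i)) *
         (\<integral>\<omega>. (\<Prod>i\<in>{l}. \<Prod>B\<in>\<pi> i. measure (p \<omega>) (\<Inter>j\<in>B. A i j)) \<partial>N))"
proof -
  define A' where "A' i j = (if i = l then A i j else UNIV)" for i j
  define G where "G x = (\<integral>\<omega>. (\<Prod>B\<in>x. measure (p \<omega>) (\<Inter>j\<in>B. A l j)) \<partial>N)" for x
  \<comment> \<open>The integral depends on group \<open>l\<close> only. Writing the summand as a
    product of factors \<open>f i\<close> turns the sum over families into a product of sums, of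
    which all but the one for \<open>l\<close> equal 1.\<close>
  define f where "f i x = at_partition q x * (if i = l then G x else 1)" for i x
  have pm: "p \<in> measurable N (prob_algebra borel)" using HSSM by (simp add: HSSM_def SSrp_def)
  have p1: "measure (p \<omega>) UNIV = 1" if "\<omega> \<in> space N" for \<omega>
  proof -
    have "prob_space (p \<omega>)" "sets (p \<omega>) = sets borel"
      using measurable_space[OF pm that] by (auto simp: space_prob_algebra)
    then show ?thesis
      using prob_space.prob_space[of "p \<omega>"] sets_eq_imp_space_eq[of "p \<omega>" borel] by simp
  qed
  have "\<P>(\<omega> in M. \<forall>i\<in>{l}. \<forall>j\<in>{1..n i}. \<xi> i j \<omega> \<in> A i j) =
      \<P>(\<omega> in M. \<forall>i\<in>{1..I}. \<forall>j\<in>{1..n i}. \<xi> i j \<omega> \<in> A' i j)"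
    using l by (intro arg_cong[where f="measure M"] Collect_cong) (auto simp: A'_def)
  also have "\<dots> = (\<Sum>\<pi>\<in>(\<Pi>\<^sub>E i\<in>{1..I}. partitions (n i)).
           (\<Prod>i=1..I. at_partition q (\<pi> i)) *
           (\<integral>\<omega>. (\<Prod>i=1..I. \<Prod>B\<in>\<pi> i. measure (p \<omega>) (\<Inter>j\<in>B. A' i j)) \<partial>N))"
    using HSSM n A unfolding HSSM_def A'_def by (auto simp del: One_nat_def)
  also have "\<dots> = (\<Sum>\<pi>\<in>(\<Pi>\<^sub>E i\<in>{1..I}. partitions (n i)). \<Prod>i=1..I. f i (\<pi> i))"
  proof (rule sum.cong[OF refl])
    fix \<pi> assume "\<pi> \<in> (\<Pi>\<^sub>E i\<in>{1..I}. partitions (n i))"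
    have "(\<integral>\<omega>. (\<Prod>i=1..I. \<Prod>B\<in>\<pi> i. measure (p \<omega>) (\<Inter>j\<in>B. A' i j)) \<partial>N) = G (\<pi> l)"
      unfolding G_def
    proof (rule Bochner_Integration.integral_cong[OF refl])
      fix \<omega> assume \<omega>: "\<omega> \<in> space N"
      have "(\<Prod>i=1..I. \<Prod>B\<in>\<pi> i. measure (p \<omega>) (\<Inter>j\<in>B. A' i j)) =
        (\<Prod>i=1..I. if i = l then \<Prod>B\<in>\<pi> l. measure (p \<omega>) (\<Inter>j\<in>B. A l j) else 1)"
        using p1[OF \<omega>] by (intro prod.cong refl) (auto simp: A'_def)
      also have "\<dots> = (\<Prod>B\<in>\<pi> l. measure (p \<omega>) (\<Inter>j\<in>B. A l j))"
        using l by (subst prod.delta) auto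
      finally show "(\<Prod>i=1..I. \<Prod>B\<in>\<pi> i. measure (p \<omega>) (\<Inter>j\<in>B. A' i j)) =
        (\<Prod>B\<in>\<pi> l. measure (p \<omega>) (\<Inter>j\<in>B. A l j))" .
    qed
    moreover have "(\<Prod>i=1..I. if i = l then G (\<pi> i) else 1) = G (\<pi> l)"
      using l by (subst prod.delta) auto
    ultimately show "(\<Prod>i=1..I. at_partition q (\<pi> i)) *
           (\<integral>\<omega>. (\<Prod>i=1..I. \<Prod>B\<in>\<pi> i. measure (p \<omega>) (\<Inter>j\<in>B. A' i j)) \<partial>N) = (\<Prod>i=1..I. f i (\<pi> i))"
      by (simp add: f_def prod.distrib)
  qed
  also have "\<dots> = (\<Prod>i=1..I. \<Sum>x\<in>partitions (n i). f i x)"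
    by (rule prod_sum_PiE[symmetric]) (auto simp: finite_partitions)
  also have "\<dots> = (\<Prod>i=1..I. if i = l then \<Sum>x\<in>partitions (n l). f l x else 1)"
  proof (intro prod.cong refl)
    fix i assume i: "i \<in> {1..I}"
    then have "(\<Sum>x\<in>partitions (n i). at_partition q x) = 1"
      using lp n by (intro sum_at_partition_eq_1[of P "R i"]) (auto simp: latent_partitions_def)
    then show "(\<Sum>x\<in>partitions (n i). f i x) = (if i = l then \<Sum>x\<in>partitions (n l). f l x else 1)"
      by (simp add: f_def)
  qed
  also have "\<dots> = (\<Prod>i\<in>{l}. \<Sum>x\<in>partitions (n i). f i x)"
    using l by (subst prod.delta) auto
  also have "\<dots> = (\<Sum>\<pi>\<in>(\<Pi>\<^sub>E i\<in>{l}. partitions (n i)). \<Prod>i\<in>{l}. f i (\<pi> i))"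
    by (rule prod_sum_PiE) (auto simp: finite_partitions)
  finally show ?thesis by (simp add: f_def G_def)
qed

theorem proposition7:
  fixes H0 :: "'x::polish_space measure"
    and q q0 :: "nat multiset \<Rightarrow> real"
    and M :: "'w measure" and \<xi> :: "nat \<Rightarrow> nat \<Rightarrow> 'w \<Rightarrow> 'x"
    and N :: "'v measure" and p :: "'v \<Rightarrow> 'x measure"
    and P :: "'u measure" and R :: "nat \<Rightarrow> nat \<Rightarrow> 'u \<Rightarrow> nat set set"
    and I :: nat and n :: "nat \<Rightarrow> nat"
  assumes "prob_space H0" and "sets H0 = sets borel"
    and "1 \<le> I"
    and "HSSM I q q0 H0 N p M \<xi>"
    and "latent_partitions I q q0 P R"
    and "\<And>i. i \<in> {1..I} \<Longrightarrow> 1 \<le> n i"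
  shows
    "(\<forall>i\<in>{1..I}. \<forall>d\<in>{1..n i}.
        \<P>(\<omega> in M. distinct_group \<xi> n i \<omega> = d) =
        (\<Sum>k=d..n i. H_star H0 d k * \<P>(\<omega> in P. latent_D_group R n i \<omega> = k))) \<and>
     (\<forall>d\<in>{1..(\<Sum>i=1..I. n i)}.
        \<P>(\<omega> in M. distinct_total I \<xi> n \<omega> = d) =
        (\<Sum>k=d..(\<Sum>i=1..I. n i). H_star H0 d k * \<P>(\<omega> in P. latent_D I R n \<omega> = k))) \<and>
     (diffuse H0 \<longrightarrow>
        (\<forall>i\<in>{1..I}. \<forall>d\<ge>1.
           \<P>(\<omega> in M. distinct_group \<xi> n i \<omega> = d) = \<P>(\<omega> in P. latent_D_group R n i \<omega> = d)) \<and>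
        (\<forall>d\<ge>1.
           \<P>(\<omega> in M. distinct_total I \<xi> n \<omega> = d) = \<P>(\<omega> in P. latent_D I R n \<omega> = d)))"
proof -
  note H0 = assms(1,2) and HSSM = assms(4) and lp = assms(5) and n = assms(6)
  have SSrp: "SSrp q0 H0 N p" and M: "prob_space M"
    and \<xi>: "\<And>i j. i \<in> {1..I} \<Longrightarrow> j \<in> {1..n i} \<Longrightarrow> \<xi> i j \<in> borel_measurable M"
    using HSSM by (auto simp: HSSM_def)
  have total: "\<P>(\<omega> in M. distinct_total I \<xi> n \<omega> = d) =
      (\<Sum>k\<le>sum n {1..I}. H_star H0 d k * \<P>(u in P. latent_D I R n u = k))" for d
  proof -
    have "\<P>(\<omega> in M. \<forall>i\<in>{1..I}. \<forall>j\<in>{1..n i}. \<xi> i j \<omega> \<in> A i j) =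
      (\<Sum>\<pi>\<in>(\<Pi>\<^sub>E i\<in>{1..I}. partitions (n i)). (\<Prod>i\<in>{1..I}. at_partition q (\<pi> i)) *
         (\<integral>\<omega>. (\<Prod>i\<in>{1..I}. \<Prod>B\<in>\<pi> i. measure (p \<omega>) (\<Inter>j\<in>B. A i j)) \<partial>N))"
      if "\<And>i j. i \<in> {1..I} \<Longrightarrow> j \<in> {1..n i} \<Longrightarrow> A i j \<in> sets borel" for A
      using HSSM n that unfolding HSSM_def by (auto simp del: One_nat_def)
    from distinct_values_eq_latent_sum[OF SSrp H0 M lp order_refl _ n \<xi> this, of d]
    have "\<P>(\<omega> in M. card ((\<lambda>(i, j). \<xi> i j \<omega>) ` Sigma {1..I} (\<lambda>i. {1..n i})) = d) =
      (\<Sum>k\<le>sum n {1..I}. H_star H0 d k * \<P>(u in P. latent_D I R n u = k))"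
      using assms(3) by (simp add: latent_D_def latent_K_def)
    moreover have "(\<lambda>(i, j). \<xi> i j \<omega>) ` Sigma {1..I} (\<lambda>i. {1..n i}) =
        {\<xi> i j \<omega> | i j. i \<in> {1..I} \<and> j \<in> {1..n i}}" for \<omega>
      by (auto simp del: One_nat_def) blast
    ultimately show ?thesis by (simp add: distinct_total_def)
  qed
  have group: "\<P>(\<omega> in M. distinct_group \<xi> n i \<omega> = d) =
      (\<Sum>k\<le>n i. H_star H0 d k * \<P>(u in P. latent_D_group R n i u = k))" if i: "i \<in> {1..I}" for i d
  proof -
    have "\<P>(\<omega> in M. card ((\<lambda>(i, j). \<xi> i j \<omega>) ` Sigma {i} (\<lambda>i. {1..n i})) = d) =
      (\<Sum>k\<le>sum n {i}. H_star H0 d k *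
        \<P>(u in P. card (R 0 (\<Sum>i\<in>{i}. card (R i (n i) u)) u) = k))"
    proof (rule distinct_values_eq_latent_sum[OF SSrp H0 M lp])
      fix A :: "nat \<Rightarrow> nat \<Rightarrow> 'x set"
      assume "\<And>l j. l \<in> {i} \<Longrightarrow> j \<in> {1..n l} \<Longrightarrow> A l j \<in> sets borel"
      then show "\<P>(\<omega> in M. \<forall>i\<in>{i}. \<forall>j\<in>{1..n i}. \<xi> i j \<omega> \<in> A i j) =
        (\<Sum>\<pi>\<in>(\<Pi>\<^sub>E i\<in>{i}. partitions (n i)). (\<Prod>i\<in>{i}. at_partition q (\<pi> i)) *
         (\<integral>\<omega>. (\<Prod>i\<in>{i}. \<Prod>B\<in>\<pi> i. measure (p \<omega>) (\<Inter>j\<in>B. A i j)) \<partial>N))"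
        by (intro HSSM_group_rect[OF HSSM lp n i]) auto
    qed (use i n \<xi> in auto)
    then have "\<P>(\<omega> in M. card ((\<lambda>(i, j). \<xi> i j \<omega>) ` Sigma {i} (\<lambda>i. {1..n i})) = d) =
      (\<Sum>k\<le>n i. H_star H0 d k * \<P>(u in P. latent_D_group R n i u = k))"
      by (simp add: latent_D_group_def latent_K_group_def)
    moreover have "(\<lambda>(i, j). \<xi> i j \<omega>) ` Sigma {i} (\<lambda>i. {1..n i}) = {\<xi> i j \<omega> | j. j \<in> {1..n i}}" for \<omega>
      by (auto simp del: One_nat_def)
    ultimately show ?thesis by (simp add: distinct_group_def)
  qed
  \<comment> \<open>Fewer than \<open>d\<close> draws cannot show \<open>d\<close> distinct values,
    so starting the sum at \<open>d\<close> loses nothing.\<close>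
  have trunc: "(\<Sum>k\<le>m. H_star H0 d k * c k) = (\<Sum>k=d..m. H_star H0 d k * c k)" for m d and c :: "nat \<Rightarrow> real"
    by (rule sum.mono_neutral_right) (auto simp: H_star_eq_0)
  \<comment> \<open>Only the term with \<open>k = d\<close> survives. For \<open>d\<close> beyond
    \<open>m\<close> both sides vanish, the right one because \<open>D\<close> is bounded by
    \<open>m\<close>.\<close>
  have diff: "(\<Sum>k\<le>m. H_star H0 d k * \<P>(u in P. D u = k)) = \<P>(u in P. D u = d)"
    if "diffuse H0" and D: "\<And>u. u \<in> space P \<Longrightarrow> D u \<le> m" for m d and D :: "'u \<Rightarrow> nat"
  proof -
    have "(\<Sum>k\<le>m. H_star H0 d k * \<P>(u in P. D u = k)) =
        (\<Sum>k\<le>m. if k = d then \<P>(u in P. D u = k) else 0)"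
      by (intro sum.cong refl) (simp add: H_star_diffuse[OF H0 that(1)])
    also have "\<dots> = (if d \<le> m then \<P>(u in P. D u = d) else 0)" by (simp add: sum.delta)
    also have "\<dots> = \<P>(u in P. D u = d)"
    proof (cases "d \<le> m")
      case False
      then have none: "{u \<in> space P. D u = d} = {}" using D by fastforce
      show ?thesis unfolding none using False by simp
    qed simp
    finally show ?thesis .
  qed
  have D_total: "latent_D I R n u \<le> sum n {1..I}" if "u \<in> space P" for u
    using sum_prob_latent_blocks(2)[OF lp order_refl _ n that] assms(3) by (simp add: latent_D_def latent_K_def)
  have D_group: "latent_D_group R n i u \<le> n i" if "i \<in> {1..I}" "u \<in> space P" for i u
    using sum_prob_latent_blocks(2)[OF lp, of "{i}" n u] n that by (simp add: latent_D_group_def latent_K_group_def)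
  show ?thesis
    unfolding trunc[symmetric] using total group diff D_total D_group by auto
qed

end
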